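(* Let $\alpha>-1$, let $\Omega\subset\mathbb{R}^2$ be a bounded domain, let $F$ satisfy conditions (H1)--(H4) of the context on $\Omega$ with ellipticity constants $0<a\le A$, let $h:\overline\Omega\to\mathbb{R}^2$ be continuous and bounded and satisfy (H5) of the context. Let $\Omega'\subset\subset\Omega$. Then there exists a constant $K=K(\Omega,\Omega',A,a,|h|_\infty)$ such that for every bounded continuous function $f$ on $\Omega$ and every positive viscosity solution $u$ of $$F(x,\nabla u,D^2u)+h(x)\cdot\nabla u\,|\nabla u|^\alpha=f(x)\quad\text{in }\Omega$$ one has $$\sup_{\Omega'}u\le K\left(\inf_{\Omega'}u+|f|_{L^\infty(\Omega)}^{\frac1{1+\alpha}}\right).$$
   Context: $N=2$ here; $S$ denotes the space of real symmetric $N\times N$ matrices, and $\alpha>-1$ is a fixed exponent. Conditions on $F$: (H1) $F:\Omega\times(\mathbb{R}^N\setminus\{0\})\times S\to\mathbb{R}$ is continuous, and for all $t\in\mathbb{R}\setminus\{0\}$, $\mu\ge0$: $F(x,tp,\mu X)=|t|^\alpha\mu F(x,p,X)$. (H2) For all $x \in \Omega$, $p\in\mathbb{R}^N\setminus\{0\}$, $M\in S$, $P\in S$ with $P\ge0$: $a|p|^\alpha\operatorname{tr}(P)\le F(x,p,M+P)-F(x,p,M)\le A|p|^\alpha\operatorname{tr}(P)$. (H3) There is a continuous function $\tilde\omega$ with $\tilde\omega(0)=0$ such that for all $x,y\in\Omega$, $p\ne0$, $X\in S$: $|F(x,p,X)-F(y,p,X)|\le\tilde\omega(|x-y|)|p|^\alpha|X|$.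 (H4) There is a continuous function $\omega$ with $\omega(0)=0$ such that if $X,Y\in S$ and $\zeta\in\mathbb{R}^+$ satisfy $$-\zeta\begin{pmatrix}I&0\\0&I\end{pmatrix}\le\begin{pmatrix}X&0\\0&Y\end{pmatrix}\le4\zeta\begin{pmatrix}I&-I\\-I&I\end{pmatrix}$$ ($I$ the $N\times N$ identity), then for all $x\neq y$ in $\Omega$: $F(x,\zeta(x-y),X)-F(y,\zeta(x-y),-Y)\le\omega(\zeta|x-y|^2)$. (When $F$ is independent of $x$, (H3) and (H4) are not needed.) (H5) Either $\alpha\le0$ and $h$ is Hölder continuous of exponent $1+\alpha$, or $\alpha>0$ and $(h(x)-h(y))\cdot(x-y)\le0$ for all $x,y$. Viscosity solutions: equations are understood in the following viscosity sense, in which one does not test when the gradient of the test function vanishes. For continuous $f$, a continuous function $u$ satisfies $F(x,\nabla u,D^2u)+h\cdot\nabla u|\nabla u|^\alpha\le f$ (resp. $\ge f$) in an open set if for every point $x_0$ of it either (i) $u$ is constant on some ball around $x_0$ and $0\le f(x)$ (resp. $0\ge f(x)$) on that ball, or (ii) for every $C^2$ function $\varphi$ such that $u-\varphi$ has a local minimum (resp. maximum) at $x_0$ and $\nabla\varphi(x_0)\ne0$, one has $F(x_0,\nabla\varphi(x_0),D^2\varphi(x_0))+h(x_0)\cdot\nabla\varphi(x_0)|\nabla\varphi(x_0)|^\alpha\le f(x_0)$ (resp. $\ge f(x_0)$). A solution is a function satisfying both inequalities. $|\cdot|_\infty$ is the sup norm; $\Omega'\subset\subset\Omega$ means $\overline{\Omega'}$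 is a compact subset of $\Omega$. *)

theory Defs
  imports "HOL-Analysis.Analysis"
begin

definition sym_mats :: "(real^'n^'n) set" where
  "sym_mats = {X. transpose X = X}"

text \<open>The usual order on symmetric matrices; it is only applied to symmetric arguments.\<close>

definition loewner_le :: "real^'n^'n \<Rightarrow> real^'n^'n \<Rightarrow> bool" where
  "loewner_le X Y \<longleftrightarrow> (\<forall>v. v \<bullet> (X *v v) \<le> v \<bullet> (Y *v v))"

text \<open>\<open>block_mat A B C D\<close> has rows \<open>(A B)\<close> and \<open>(C D)\<close>.\<close>

definition block_mat ::
  "real^'n^'n \<Rightarrow> real^'n^'n \<Rightarrow> real^'n^'n \<Rightarrow> real^'n^'n \<Rightarrow> real^('n + 'n)^('n + 'n)" where
  "block_mat A B C D =
    (\<chi> i j. case i of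
        Inl k \<Rightarrow> (case j of Inl l \<Rightarrow> A $ k $ l | Inr l \<Rightarrow> B $ k $ l)
      | Inr k \<Rightarrow> (case j of Inl l \<Rightarrow> C $ k $ l | Inr l \<Rightarrow> D $ k $ l))"

definition sup_norm_on :: "'a set \<Rightarrow> ('a \<Rightarrow> 'b::real_normed_vector) \<Rightarrow> real" where
  "sup_norm_on S g = (SUP x\<in>S. norm (g x))"

text \<open>
  The operator \<open>F\<close> is a total function; its values matter only for \<open>x \<in> \<Omega>\<close>, \<open>p \<noteq> 0\<close> and
  symmetric matrices. Likewise the moduli of continuity matter only on \<open>[0, \<infinity>)\<close>.
\<close>

type_synonym 'n operator = "real^'n \<Rightarrow> real^'n \<Rightarrow> real^'n^'n \<Rightarrow> real"

definition cond_H1 :: "real \<Rightarrow> (real^'n) set \<Rightarrow> 'n operator \<Rightarrow> bool" where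
  "cond_H1 \<alpha> \<Omega> F \<longleftrightarrow>
     continuous_on (\<Omega> \<times> (- {0}) \<times> sym_mats) (\<lambda>(x, p, X). F x p X) \<and>
     (\<forall>x\<in>\<Omega>. \<forall>p. \<forall>X\<in>sym_mats. \<forall>t \<mu>. p \<noteq> 0 \<longrightarrow> t \<noteq> 0 \<longrightarrow> 0 \<le> \<mu> \<longrightarrow>
        F x (t *\<^sub>R p) (\<mu> *\<^sub>R X) = \<bar>t\<bar> powr \<alpha> * \<mu> * F x p X)"

definition cond_H2 :: "real \<Rightarrow> real \<Rightarrow> real \<Rightarrow> (real^'n) set \<Rightarrow> 'n operator \<Rightarrow> bool" where
  "cond_H2 \<alpha> a A \<Omega> F \<longleftrightarrow>
     (\<forall>x\<in>\<Omega>. \<forall>p. \<forall>M\<in>sym_mats. \<forall>P\<in>sym_mats. p \<noteq> 0 \<longrightarrow> loewner_le 0 P \<longrightarrow>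
        a * norm p powr \<alpha> * trace P \<le> F x p (M + P) - F x p M \<and>
        F x p (M + P) - F x p M \<le> A * norm p powr \<alpha> * trace P)"

text \<open>The norm of a matrix is the Frobenius norm; another choice only rescales \<open>\<omega>\<close>.\<close>

definition cond_H3 :: "real \<Rightarrow> (real^'n) set \<Rightarrow> 'n operator \<Rightarrow> bool" where
  "cond_H3 \<alpha> \<Omega> F \<longleftrightarrow>
     (\<exists>\<omega>::real \<Rightarrow> real. continuous_on {0..} \<omega> \<and> \<omega> 0 = 0 \<and>
        (\<forall>x\<in>\<Omega>. \<forall>y\<in>\<Omega>. \<forall>p. \<forall>X\<in>sym_mats. p \<noteq> 0 \<longrightarrow>
           \<bar>F x p X - F y p X\<bar> \<le> \<omega> (norm (x - y)) * norm p powr \<alpha> * norm X))"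

definition cond_H4 :: "(real^'n) set \<Rightarrow> 'n operator \<Rightarrow> bool" where
  "cond_H4 \<Omega> F \<longleftrightarrow>
     (\<exists>\<omega>::real \<Rightarrow> real. continuous_on {0..} \<omega> \<and> \<omega> 0 = 0 \<and>
        (\<forall>X\<in>sym_mats. \<forall>Y\<in>sym_mats. \<forall>\<zeta>>0.
           loewner_le (- \<zeta> *\<^sub>R block_mat (mat 1) 0 0 (mat 1)) (block_mat X 0 0 Y) \<longrightarrow>
           loewner_le (block_mat X 0 0 Y)
             ((4 * \<zeta>) *\<^sub>R block_mat (mat 1) (- mat 1) (- mat 1) (mat 1)) \<longrightarrow>
           (\<forall>x\<in>\<Omega>. \<forall>y\<in>\<Omega>. x \<noteq> y \<longrightarrow>
              F x (\<zeta> *\<^sub>R (x - y)) X - F y (\<zeta> *\<^sub>R (x - y)) (- Y) \<le> \<omega> (\<zeta> * (norm (x - y))\<^sup>2))))"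

definition holder_on :: "real \<Rightarrow> 'a::metric_space set \<Rightarrow> ('a \<Rightarrow> 'b::metric_space) \<Rightarrow> bool" where
  "holder_on \<gamma> S h \<longleftrightarrow> (\<exists>C. \<forall>x\<in>S. \<forall>y\<in>S. dist (h x) (h y) \<le> C * dist x y powr \<gamma>)"

definition cond_H5 :: "real \<Rightarrow> (real^'n) set \<Rightarrow> (real^'n \<Rightarrow> real^'n) \<Rightarrow> bool" where
  "cond_H5 \<alpha> S h \<longleftrightarrow>
     (\<alpha> \<le> 0 \<and> holder_on (1 + \<alpha>) S h) \<or>
     (\<alpha> > 0 \<and> (\<forall>x\<in>S. \<forall>y\<in>S. (h x - h y) \<bullet> (x - y) \<le> 0))"

text \<open>\<open>\<phi>\<close> is \<open>C\<^sup>2\<close> on the open set \<open>U\<close>, with gradient \<open>D\<phi>\<close> and Hessian \<open>D2\<phi>\<close>.\<close>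

definition C2_on ::
  "(real^'n) set \<Rightarrow> (real^'n \<Rightarrow> real) \<Rightarrow> (real^'n \<Rightarrow> real^'n) \<Rightarrow> (real^'n \<Rightarrow> real^'n^'n) \<Rightarrow> bool" where
  "C2_on U \<phi> D\<phi> D2\<phi> \<longleftrightarrow>
     (\<forall>x\<in>U. GDERIV \<phi> x :> D\<phi> x) \<and>
     (\<forall>x\<in>U. (D\<phi> has_derivative (\<lambda>v. D2\<phi> x *v v)) (at x)) \<and>
     continuous_on U D2\<phi>"

definition local_min_at :: "('a::topological_space \<Rightarrow> real) \<Rightarrow> 'a \<Rightarrow> bool" where
  "local_min_at g x0 \<longleftrightarrow> eventually (\<lambda>x. g x0 \<le> g x) (nhds x0)"

definition local_max_at :: "('a::topological_space \<Rightarrow> real) \<Rightarrow> 'a \<Rightarrow> bool" where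
  "local_max_at g x0 \<longleftrightarrow> eventually (\<lambda>x. g x \<le> g x0) (nhds x0)"

text \<open>
  Supersolutions satisfy \<open>F(x, \<nabla>u, D\<^sup>2u) + h \<cdot> \<nabla>u |\<nabla>u|\<^sup>\<alpha> \<le> f\<close> in the open set \<open>\<Omega>\<close>, subsolutions
  the reverse inequality. At a point where \<open>u\<close> is locally constant the second alternative holds
  vacuously, since no test function touching \<open>u\<close> there has a nonzero gradient.
\<close>

definition viscosity_supersol ::
  "real \<Rightarrow> (real^'n) set \<Rightarrow> 'n operator \<Rightarrow> (real^'n \<Rightarrow> real^'n) \<Rightarrow> (real^'n \<Rightarrow> real) \<Rightarrow> (real^'n \<Rightarrow> real) \<Rightarrow> bool"
  where
  "viscosity_supersol \<alpha> \<Omega> F h f u \<longleftrightarrow> continuous_on \<Omega> u \<and>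
     (\<forall>x0\<in>\<Omega>.
        (\<exists>r>0. ball x0 r \<subseteq> \<Omega> \<and> u constant_on ball x0 r \<and> (\<forall>x\<in>ball x0 r. 0 \<le> f x)) \<or>
        (\<forall>\<phi> D\<phi> D2\<phi>. C2_on \<Omega> \<phi> D\<phi> D2\<phi> \<longrightarrow> local_min_at (\<lambda>x. u x - \<phi> x) x0 \<longrightarrow> D\<phi> x0 \<noteq> 0 \<longrightarrow>
           F x0 (D\<phi> x0) (D2\<phi> x0) + (h x0 \<bullet> D\<phi> x0) * norm (D\<phi> x0) powr \<alpha> \<le> f x0))"

definition viscosity_subsol ::
  "real \<Rightarrow> (real^'n) set \<Rightarrow> 'n operator \<Rightarrow> (real^'n \<Rightarrow> real^'n) \<Rightarrow> (real^'n \<Rightarrow> real) \<Rightarrow> (real^'n \<Rightarrow> real) \<Rightarrow> bool"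
  where
  "viscosity_subsol \<alpha> \<Omega> F h f u \<longleftrightarrow> continuous_on \<Omega> u \<and>
     (\<forall>x0\<in>\<Omega>.
        (\<exists>r>0. ball x0 r \<subseteq> \<Omega> \<and> u constant_on ball x0 r \<and> (\<forall>x\<in>ball x0 r. 0 \<ge> f x)) \<or>
        (\<forall>\<phi> D\<phi> D2\<phi>. C2_on \<Omega> \<phi> D\<phi> D2\<phi> \<longrightarrow> local_max_at (\<lambda>x. u x - \<phi> x) x0 \<longrightarrow> D\<phi> x0 \<noteq> 0 \<longrightarrow>
           F x0 (D\<phi> x0) (D2\<phi> x0) + (h x0 \<bullet> D\<phi> x0) * norm (D\<phi> x0) powr \<alpha> \<ge> f x0))"

definition viscosity_sol ::
  "real \<Rightarrow> (real^'n) set \<Rightarrow> 'n operator \<Rightarrow> (real^'n \<Rightarrow> real^'n) \<Rightarrow> (real^'n \<Rightarrow> real) \<Rightarrow> (real^'n \<Rightarrow> real) \<Rightarrow> bool"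
  where
  "viscosity_sol \<alpha> \<Omega> F h f u \<longleftrightarrow>
     viscosity_supersol \<alpha> \<Omega> F h f u \<and> viscosity_subsol \<alpha> \<Omega> F h f u"

end

theory Submission
  imports Defs
begin

text \<open>
  The solution \<open>u\<close> is compared with explicit smooth barriers \<open>m exp (l \<psi>)\<close> of nowhere vanishing gradient, so that no comparison principle between viscosity
  solutions is needed. Let \<open>M = u x\<close> be large compared with \<open>|f| powr (1 / (1 + \<alpha>))\<close>. As \<open>u\<close> is a subsolution, the
  component of \<open>{u > M / 2}\<close> at \<open>x\<close> reaches the boundary of a ball around \<open>x\<close>, so it contains a path
  crossing a thin rectangle from bottom to top. If the supersolution \<open>u\<close> were too small near the centre
  of the rectangle, then barriers positive inside a parabola opening to the right or to the left would
  yield a path in \<open>{u < M/2}\<close> crossing the rectangle from left to right. In the plane the two paths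
  must meet, a contradiction. Hence \<open>u \<ge> c M\<close> on a small ball near \<open>x\<close>, and a radial barrier extends
  this to a full neighbourhood of \<open>x\<close>; a chain of balls concludes.
\<close>

section \<open>Structure inequalities and exponential barriers\<close>

definition outer :: "real^'n \<Rightarrow> real^'n^'n" where
  "outer q = (\<chi> i j. q $ i * q $ j)"

lemma outer_mult_vec: "outer q *v v = (q \<bullet> v) *\<^sub>R q"
  by (simp add: outer_def matrix_vector_mult_def vec_eq_iff inner_vec_def sum_distrib_left mult_ac)

lemma trace_outer: "trace (outer q) = (norm q)\<^sup>2"
  by (simp add: trace_def outer_def power2_norm_eq_inner inner_vec_def)

lemma outer_sym: "outer q \<in> sym_mats"
  by (simp add: sym_mats_def outer_def transpose_def vec_eq_iff mult.commute)

lemma outer_nonneg: "loewner_le 0 (outer q)"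
  by (simp add: loewner_le_def outer_mult_vec inner_commute)

lemma sym_mats_scaleR: "X \<in> sym_mats \<Longrightarrow> t *\<^sub>R X \<in> sym_mats"
  by (simp add: sym_mats_def transpose_def vec_eq_iff)

lemma sym_mats_diff: "X \<in> sym_mats \<Longrightarrow> Y \<in> sym_mats \<Longrightarrow> X - Y \<in> sym_mats"
  by (simp add: sym_mats_def transpose_def vec_eq_iff)

lemma zero_sym_mats: "0 \<in> sym_mats"
  by (simp add: sym_mats_def transpose_def vec_eq_iff)

lemma trace_scaleR: "trace (t *\<^sub>R X) = t * trace (X :: real^'n^'n)"
  by (simp add: trace_def sum_distrib_left)

lemma loewner_scaleR: "0 \<le> t \<Longrightarrow> loewner_le 0 X \<Longrightarrow> loewner_le 0 (t *\<^sub>R X)"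
  by (simp add: loewner_le_def scaleR_matrix_vector_assoc[symmetric])

text \<open>Homogeneity with \<open>\<mu> = 0\<close> gives \<open>F x p 0 = 0\<close>. Then (H2) is
  used twice: for adding \<open>Q\<close> to \<open>0\<close> and for adding \<open>P\<close> to
  \<open>Q - P\<close>.\<close>

lemma pucci_bounds:
  assumes H1: "cond_H1 \<alpha> \<Omega> F" and H2: "cond_H2 \<alpha> a A \<Omega> F"
    and x: "x \<in> \<Omega>" and p: "p \<noteq> 0"
    and P: "P \<in> sym_mats" "loewner_le 0 P" and Q: "Q \<in> sym_mats" "loewner_le 0 Q"
  shows "norm p powr \<alpha> * (a * trace Q - A * trace P) \<le> F x p (Q - P)"
    and "F x p (Q - P) \<le> norm p powr \<alpha> * (A * trace Q - a * trace P)"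
proof -
  have "F x (1 *\<^sub>R p) (0 *\<^sub>R 0) = \<bar>1\<bar> powr \<alpha> * 0 * F x p 0"
    using H1 x p zero_sym_mats unfolding cond_H1_def by fastforce
  then have F0: "F x p 0 = 0" by simp
  have *: "a * norm p powr \<alpha> * trace Y \<le> F x p (M + Y) - F x p M \<and>
     F x p (M + Y) - F x p M \<le> A * norm p powr \<alpha> * trace Y"
    if "M \<in> sym_mats" "Y \<in> sym_mats" "loewner_le 0 Y" for M Y
    using H2 x p that unfolding cond_H2_def by blast
  note 1 = *[OF zero_sym_mats Q] and 2 = *[OF sym_mats_diff[OF Q(1) P(1)] P]
  show "norm p powr \<alpha> * (a * trace Q - A * trace P) \<le> F x p (Q - P)"
    and "F x p (Q - P) \<le> norm p powr \<alpha> * (A * trace Q - a * trace P)"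
    using 1 2 F0 by (auto simp: algebra_simps)
qed

text \<open>The Hessian of the phase is a constant matrix, so the error that the parameter
  \<open>l\<close> of the exponential has to dominate is the fixed number
  \<open>trace P\<close>.\<close>

definition concave_phase ::
  "(real^'n \<Rightarrow> real) \<Rightarrow> (real^'n \<Rightarrow> real^'n) \<Rightarrow> real^'n^'n \<Rightarrow> bool" where
  "concave_phase \<psi> q P \<longleftrightarrow> (\<forall>x. GDERIV \<psi> x :> q x) \<and>
     (\<forall>x. (q has_derivative (\<lambda>v. - (P *v v))) (at x)) \<and> P \<in> sym_mats \<and> loewner_le 0 P"

text \<open>Exponentiation puts an extra factor \<open>l\<close> on the rank-one gradient part, but
  not on \<open>P\<close>; this is what large \<open>l\<close> exploits. The sign of
  \<open>s\<close> is left free: positive for test functions from below, negative for those from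
  above.\<close>

lemma C2_on_exp_phase:
  assumes "concave_phase \<psi> q P"
  shows "C2_on U (\<lambda>x. s * exp (l * \<psi> x)) (\<lambda>x. (s * l * exp (l * \<psi> x)) *\<^sub>R q x)
    (\<lambda>x. (s * l * exp (l * \<psi> x)) *\<^sub>R (l *\<^sub>R outer (q x) - P))"
proof -
  have d: "(\<psi> has_derivative (\<lambda>v. v \<bullet> q x)) (at x)" for x
    using assms unfolding concave_phase_def gderiv_def by blast
  have dq: "(q has_derivative (\<lambda>v. - (P *v v))) (at x)" for x
    using assms unfolding concave_phase_def by blast
  have c: "continuous_on U \<psi>" "continuous_on U q"
    using d dq by (meson continuous_at_imp_continuous_on has_derivative_continuous)+
  have "GDERIV (\<lambda>x. s * exp (l * \<psi> x)) x :> (s * l * exp (l * \<psi> x)) *\<^sub>R q x" for x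
    unfolding gderiv_def
    by (rule has_derivative_eq_rhs, (rule derivative_intros d)+) (auto simp: algebra_simps)
  moreover have "((\<lambda>x. (s * l * exp (l * \<psi> x)) *\<^sub>R q x) has_derivative
      (\<lambda>v. (s * l * exp (l * \<psi> x)) *\<^sub>R (l *\<^sub>R outer (q x) - P) *v v)) (at x)" for x
    by (rule has_derivative_eq_rhs, (rule derivative_intros d dq)+)
      (auto simp: fun_eq_iff scaleR_matrix_vector_assoc[symmetric] matrix_vector_mult_diff_rdistrib
         outer_mult_vec algebra_simps inner_commute)
  moreover have "continuous_on U (\<lambda>x. (s * l * exp (l * \<psi> x)) *\<^sub>R (l *\<^sub>R outer (q x) - P))"
    unfolding outer_def
    by (intro continuous_intros c)
  ultimately show ?thesis unfolding C2_on_def by blast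
qed

text \<open>Where \<open>u\<close> is constant, an extremum of \<open>u\<close> minus the barrier is
  an extremum of the barrier, whose gradient would vanish. This excludes the first alternative in
  the viscosity definition at a touching point.\<close>

lemma not_local_extremum_of_phase:
  assumes ph: "concave_phase \<psi> q P" and q: "q x0 \<noteq> 0" and sl: "s \<noteq> 0" "l \<noteq> 0"
    and r: "r > 0" and const: "u constant_on ball x0 r"
  shows "\<not> local_min_at (\<lambda>x. u x - s * exp (l * \<psi> x)) x0"
    and "\<not> local_max_at (\<lambda>x. u x - s * exp (l * \<psi> x)) x0"
proof -
  let ?\<phi> = "\<lambda>x. s * exp (l * \<psi> x)"
  let ?p = "(s * l * exp (l * \<psi> x0)) *\<^sub>R q x0"
  obtain k where k: "\<And>x. x \<in> ball x0 r \<Longrightarrow> u x = k"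
    using const unfolding constant_on_def by blast
  have ev: "eventually (\<lambda>x. u x = k) (nhds x0)"
    unfolding eventually_nhds using k r by (intro exI[of _ "ball x0 r"]) auto
  have D: "(?\<phi> has_derivative (\<lambda>v. v \<bullet> ?p)) (at x0)"
    using C2_on_exp_phase[OF ph, of UNIV s l] unfolding C2_on_def gderiv_def by auto
  have p: "?p \<noteq> 0" using q sl by simp
  have "(\<lambda>v. v \<bullet> ?p) = (\<lambda>v. 0)" 
    if *: "eventually (\<lambda>x. ?\<phi> x \<le> ?\<phi> x0) (nhds x0) \<or> eventually (\<lambda>x. ?\<phi> x0 \<le> ?\<phi> x) (nhds x0)"
  proof -
    obtain d where d: "d > 0" "(\<forall>y\<in>ball x0 d. ?\<phi> y \<le> ?\<phi> x0) \<or> (\<forall>y\<in>ball x0 d. ?\<phi> x0 \<le> ?\<phi> y)"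
      using * unfolding eventually_nhds_metric by (metis mem_ball dist_commute)
    show ?thesis
      by (rule differential_zero_maxmin[OF _ open_ball D d(2)]) (use d(1) in simp)
  qed
  moreover have "(\<lambda>v. v \<bullet> ?p) \<noteq> (\<lambda>v. 0)"
    using p by (metis inner_eq_zero_iff)
  ultimately have no: "\<not> eventually (\<lambda>x. ?\<phi> x \<le> ?\<phi> x0) (nhds x0)" "\<not> eventually (\<lambda>x. ?\<phi> x0 \<le> ?\<phi> x) (nhds x0)"
    by blast+
  have u0: "u x0 = k" using k r by simp
  show "\<not> local_min_at (\<lambda>x. u x - ?\<phi> x) x0"
    using no(1) ev eventually_elim2 unfolding local_min_at_def u0
    by (smt (verit) eventually_mono eventually_conj)
  show "\<not> local_max_at (\<lambda>x. u x - ?\<phi> x) x0"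
    using no(2) ev unfolding local_max_at_def u0
    by (smt (verit) eventually_mono eventually_conj)
qed

text \<open>\<open>H\<close> and \<open>S\<close> are any upper bounds for the drift and the source
  rather than their sup norms, so constants built from \<open>H\<close> serve all drifts of that
  size.\<close>

locale harnack_setting =
  fixes \<alpha> a A H S :: real and \<Omega> :: "(real^2) set" and F h f u
  assumes alpha: "\<alpha> > -1" and op: "open \<Omega>" and a: "0 < a" and A: "0 \<le> A"
    and H1: "cond_H1 \<alpha> \<Omega> F" and H2: "cond_H2 \<alpha> a A \<Omega> F"
    and hH: "\<And>x. x \<in> \<Omega> \<Longrightarrow> norm (h x) \<le> H" and fS: "\<And>x. x \<in> \<Omega> \<Longrightarrow> \<bar>f x\<bar> \<le> S"
    and sol: "viscosity_sol \<alpha> \<Omega> F h f u" and pos: "\<And>x. x \<in> \<Omega> \<Longrightarrow> u x > 0"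
begin

lemma cont: "continuous_on \<Omega> u"
  using sol unfolding viscosity_sol_def viscosity_supersol_def by blast

text \<open>The right-hand side factors as \<open>norm p powr (1 + \<alpha>)\<close> times
  \<open>a * l * norm q - A * T / norm q - H\<close>. The bracket increases with
  \<open>norm q\<close>, so \<open>lam\<close> makes it at least 1, and \<open>big\<close> makes the
  power exceed \<open>S\<close>. The size of \<open>l\<close> and the amplitude \<open>m\<close> are
  thus handled separately.\<close>

lemma barrier_strict:
  assumes x0: "x0 \<in> \<Omega>" and q0: "0 < q0" "q0 \<le> norm q" and T: "0 \<le> T"
    and m: "0 < m" "0 < l"
    and lam: "1 \<le> a * l * q0 - A * T / q0 - H"
    and big: "S powr (1 / (1 + \<alpha>)) < m * l * q0 * e" and e: "e > 0"
    and p: "norm p = m * l * e * norm q"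
  shows "S < norm p powr \<alpha> * (a * (m * l * e * l * (norm q)\<^sup>2) - A * (m * l * e * T)) - H * norm p powr \<alpha> * norm p"
proof -
  have n: "norm q > 0" using q0 by linarith
  then have "norm p > 0" unfolding p using m e by simp
  note n = n this
  have S: "0 \<le> S" using fS[OF x0] by auto
  have "S = (S powr (1 / (1 + \<alpha>))) powr (1 + \<alpha>)"
    using alpha S by (simp add: powr_powr)
  also have "\<dots> < norm p powr (1 + \<alpha>)"
  proof (rule powr_less_mono2)
    have "m * l * q0 * e \<le> norm p" unfolding p using q0 m e by (simp add: mult_ac)
    then show "S powr (1 / (1 + \<alpha>)) < norm p" using big by simp
  qed (use alpha in auto)
  also have "\<dots> = norm p powr \<alpha> * norm p * 1" using n by (simp add: powr_add)
  also have "\<dots> \<le> norm p powr \<alpha> * norm p * (a * l * norm q - A * T / norm q - H)"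
  proof (rule mult_left_mono)
    have "a * l * q0 \<le> a * l * norm q" using q0 a m by (simp add: mult_left_mono)
    moreover have "A * T / norm q \<le> A * T / q0" using A T q0 n by (intro divide_left_mono mult_pos_pos) auto
    ultimately show "1 \<le> a * l * norm q - A * T / norm q - H" using lam by linarith
  qed simp
  also have "\<dots> = norm p powr \<alpha> * (a * (m * l * e * l * (norm q)\<^sup>2) - A * (m * l * e * T)) - H * norm p powr \<alpha> * norm p"
    unfolding p using n by (simp add: field_simps power2_eq_square)
  finally show ?thesis .
qed

lemma drift_bound:
  assumes "x \<in> \<Omega>"
  shows "\<bar>(h x \<bullet> p) * norm p powr \<alpha>\<bar> \<le> H * norm p powr \<alpha> * norm p"
proof -
  have "\<bar>h x \<bullet> p\<bar> \<le> H * norm p"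
    using hH[OF assms] Cauchy_Schwarz_ineq2[of "h x" p] by (meson mult_right_mono norm_ge_zero order_trans)
  then have "\<bar>h x \<bullet> p\<bar> * norm p powr \<alpha> \<le> H * norm p * norm p powr \<alpha>"
    by (intro mult_right_mono) auto
  then show ?thesis by (simp add: abs_mult mult_ac)
qed

text \<open>The barrier is a strict subsolution at \<open>x0\<close>: by the lower Pucci bound, its
  Hessian term beats the drift and still exceeds \<open>S\<close>. It therefore cannot touch the
  supersolution \<open>u\<close> from below.\<close>

lemma no_local_min:
  assumes ph: "concave_phase \<psi> q P" and x0: "x0 \<in> \<Omega>" and q0: "0 < q0" "q0 \<le> norm (q x0)"
    and m: "0 < m" "0 < l" and P: "0 \<le> trace P"
    and lam: "1 \<le> a * l * q0 - A * trace P / q0 - H"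
    and big: "S powr (1 / (1 + \<alpha>)) < m * l * q0 * exp (l * \<psi> x0)"
  shows "\<not> local_min_at (\<lambda>x. u x - m * exp (l * \<psi> x)) x0"
proof
  assume min: "local_min_at (\<lambda>x. u x - m * exp (l * \<psi> x)) x0"
  define t where "t = m * l * exp (l * \<psi> x0)"
  have t: "t > 0" unfolding t_def using m by simp
  let ?p = "t *\<^sub>R q x0"
  have q: "q x0 \<noteq> 0" using q0 by auto
  then have p: "?p \<noteq> 0" using t by simp
  from sol x0 have "(\<exists>r>0. ball x0 r \<subseteq> \<Omega> \<and> u constant_on ball x0 r \<and> (\<forall>x\<in>ball x0 r. 0 \<le> f x)) \<or>
        (\<forall>\<phi> D\<phi> D2\<phi>. C2_on \<Omega> \<phi> D\<phi> D2\<phi> \<longrightarrow> local_min_at (\<lambda>x. u x - \<phi> x) x0 \<longrightarrow> D\<phi> x0 \<noteq> 0 \<longrightarrow>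
           F x0 (D\<phi> x0) (D2\<phi> x0) + (h x0 \<bullet> D\<phi> x0) * norm (D\<phi> x0) powr \<alpha> \<le> f x0)"
    unfolding viscosity_sol_def viscosity_supersol_def by blast
  moreover have "\<not> (\<exists>r>0. ball x0 r \<subseteq> \<Omega> \<and> u constant_on ball x0 r \<and> (\<forall>x\<in>ball x0 r. 0 \<le> f x))"
    using not_local_extremum_of_phase(1)[of \<psi> q P x0 m l, OF ph q] m min by force
  ultimately have "F x0 ?p (t *\<^sub>R (l *\<^sub>R outer (q x0) - P)) + (h x0 \<bullet> ?p) * norm ?p powr \<alpha> \<le> f x0"
    using C2_on_exp_phase[OF ph, of \<Omega> m l] min p unfolding t_def by blast
  moreover have "norm ?p powr \<alpha> * (a * trace ((t * l) *\<^sub>R outer (q x0)) - A * trace (t *\<^sub>R P))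
      \<le> F x0 ?p ((t * l) *\<^sub>R outer (q x0) - t *\<^sub>R P)"
    using ph t m unfolding concave_phase_def
    by (intro pucci_bounds(1)[OF H1 H2 x0 p] sym_mats_scaleR loewner_scaleR outer_sym outer_nonneg) auto
  moreover have "S < norm ?p powr \<alpha> * (a * (t * l * (norm (q x0))\<^sup>2) - A * (t * trace P)) - H * norm ?p powr \<alpha> * norm ?p"
    using barrier_strict[OF x0 q0 P m lam big, of ?p] t unfolding t_def by simp
  ultimately show False
    using drift_bound[OF x0, of ?p] fS[OF x0] unfolding trace_scaleR trace_outer scaleR_diff_right scaleR_scaleR by linarith
qed

text \<open>The mirror image: with amplitude \<open>- m\<close> the barrier is a strict
  supersolution, and the upper Pucci bound contradicts the subsolution inequality for
  \<open>u\<close>.\<close>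

lemma no_local_max:
  assumes ph: "concave_phase \<psi> q P" and x0: "x0 \<in> \<Omega>" and q0: "0 < q0" "q0 \<le> norm (q x0)"
    and m: "0 < m" "0 < l" and P: "0 \<le> trace P"
    and lam: "1 \<le> a * l * q0 - A * trace P / q0 - H"
    and big: "S powr (1 / (1 + \<alpha>)) < m * l * q0 * exp (l * \<psi> x0)"
  shows "\<not> local_max_at (\<lambda>x. u x + m * exp (l * \<psi> x)) x0"
proof
  assume "local_max_at (\<lambda>x. u x + m * exp (l * \<psi> x)) x0"
  then have max: "local_max_at (\<lambda>x. u x - (- m) * exp (l * \<psi> x)) x0" by simp
  define t where "t = m * l * exp (l * \<psi> x0)"
  have t: "t > 0" unfolding t_def using m by simp
  let ?p = "(- t) *\<^sub>R q x0"
  have q: "q x0 \<noteq> 0" using q0 by auto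
  then have p: "?p \<noteq> 0" using t by simp
  from sol x0 have "(\<exists>r>0. ball x0 r \<subseteq> \<Omega> \<and> u constant_on ball x0 r \<and> (\<forall>x\<in>ball x0 r. 0 \<ge> f x)) \<or>
        (\<forall>\<phi> D\<phi> D2\<phi>. C2_on \<Omega> \<phi> D\<phi> D2\<phi> \<longrightarrow> local_max_at (\<lambda>x. u x - \<phi> x) x0 \<longrightarrow> D\<phi> x0 \<noteq> 0 \<longrightarrow>
           F x0 (D\<phi> x0) (D2\<phi> x0) + (h x0 \<bullet> D\<phi> x0) * norm (D\<phi> x0) powr \<alpha> \<ge> f x0)"
    unfolding viscosity_sol_def viscosity_subsol_def by blast
  moreover have "\<not> (\<exists>r>0. ball x0 r \<subseteq> \<Omega> \<and> u constant_on ball x0 r \<and> (\<forall>x\<in>ball x0 r. 0 \<ge> f x))"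
    using not_local_extremum_of_phase(2)[of \<psi> q P x0 "- m" l, OF ph q] m max by force
  moreover have t': "- t = - m * l * exp (l * \<psi> x0)" unfolding t_def by simp
  ultimately have F: "F x0 ?p ((- t) *\<^sub>R (l *\<^sub>R outer (q x0) - P)) + (h x0 \<bullet> ?p) * norm ?p powr \<alpha> \<ge> f x0"
    using C2_on_exp_phase[OF ph, of \<Omega> "- m" l] max p unfolding t' by blast
  \<comment> \<open>The negative amplitude exchanges the roles of the two nonnegative matrices, so
    the rank-one part is now the one subtracted.\<close>
  have "(- t) *\<^sub>R (l *\<^sub>R outer (q x0) - P) = t *\<^sub>R P - (t * l) *\<^sub>R outer (q x0)"
    by (simp add: algebra_simps)
  note F[unfolded this]
  moreover have "F x0 ?p (t *\<^sub>R P - (t * l) *\<^sub>R outer (q x0))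
      \<le> norm ?p powr \<alpha> * (A * trace (t *\<^sub>R P) - a * trace ((t * l) *\<^sub>R outer (q x0)))"
    using ph t m unfolding concave_phase_def
    by (intro pucci_bounds(2)[OF H1 H2 x0 p] sym_mats_scaleR loewner_scaleR outer_sym outer_nonneg) auto
  moreover have "S < norm ?p powr \<alpha> * (a * (t * l * (norm (q x0))\<^sup>2) - A * (t * trace P)) - H * norm ?p powr \<alpha> * norm ?p"
    using barrier_strict[OF x0 q0 P m lam big, of ?p] t unfolding t_def by simp
  ultimately show False
    using drift_bound[OF x0, of ?p] fS[OF x0]
    unfolding trace_scaleR trace_outer right_diff_distrib[of "norm ?p powr \<alpha>"] by linarith
qed

end

section \<open>Topology\<close>

text \<open>The component of \<open>x\<close> in the sublevel set cannot be compactly contained in \<open>U\<close>, since its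
  minimiser would then be a local minimum.\<close>

lemma sublevel_component_reaches_frontier:
  fixes w :: "'a::euclidean_space \<Rightarrow> real"
  assumes U: "open U" "bounded U" and w: "continuous_on (closure U) w"
    and nomin: "\<And>y. y \<in> U \<Longrightarrow> \<not> local_min_at w y"
    and x: "x \<in> U" "w x < \<kappa>"
  obtains W z where "open W" "path_connected W" "x \<in> W" "W \<subseteq> {y\<in>U. w y < \<kappa>}"
    "z \<in> closure W" "z \<in> frontier U" "w z \<le> \<kappa>"
proof -
  define V where "V = {y\<in>U. w y < \<kappa>}"
  define W where "W = connected_component_set V x"
  have "continuous_on U w" using w closure_subset continuous_on_subset by blast
  then have "open V" unfolding V_def
    using continuous_open_preimage[OF _ U(1), of w "{..<\<kappa>}"] by (simp add: vimage_def Int_def)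
  then have oW: "open W" unfolding W_def by (rule open_connected_component)
  have xW: "x \<in> W" using x unfolding W_def V_def by (simp add: connected_component_refl)
  have WV: "W \<subseteq> V" unfolding W_def by (rule connected_component_subset)
  have cl: "closure W \<subseteq> closure U" using WV unfolding V_def by (intro closure_mono) blast
  have "closure W \<inter> frontier U \<noteq> {}"
  proof
    assume no: "closure W \<inter> frontier U = {}"
    then have cU: "closure W \<subseteq> U"
      using cl U(1) by (auto simp: frontier_def interior_open)
    have "compact (closure W)" using U(2) cl by (metis compact_closure bounded_closure bounded_subset closure_closure)
    then obtain y where y: "y \<in> closure W" "\<And>y'. y' \<in> closure W \<Longrightarrow> w y \<le> w y'"
      using continuous_attains_inf[of "closure W" w] xW closure_subset w cl continuous_on_subset
      by (metis empty_iff subsetD)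
    have "w y \<le> w x" using y(2) xW closure_subset by blast
    then have "y \<in> V" using x y(1) cU unfolding V_def by auto
    \<comment> \<open>A component is relatively closed in \<open>V\<close>, so the minimiser over
      \<open>closure W\<close>, already known to be in \<open>V\<close>, lies in the open set
      \<open>W\<close> itself.\<close>
    moreover have "closedin (top_of_set V) W"
      unfolding W_def by (rule closedin_connected_component)
    ultimately have "y \<in> W" using y(1) WV by (auto simp: closedin_closed_eq closure_closed closedin_limpt closure_def)
    then have "local_min_at w y"
      unfolding local_min_at_def eventually_nhds using oW y(2) closure_subset by blast
    then show False using nomin \<open>y \<in> V\<close> unfolding V_def by blast
  qed
  then obtain z where z: "z \<in> closure W" "z \<in> frontier U" by blast
  have "w z \<le> \<kappa>"
  proof (rule continuous_le_on_closure[of W w z])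
    show "continuous_on (closure W) w" using w cl continuous_on_subset by blast
    show "w y \<le> \<kappa>" if "y \<in> W" for y using that WV unfolding V_def by force
  qed (use z in auto)
  then show ?thesis
    using that[of W z] oW xW WV z connected_open_path_connected[OF oW] connected_connected_component
    unfolding V_def W_def by blast
qed

text \<open>Clamping each path to the rectangle turns Fashoda's theorem into a statement about paths that
  overshoot it: a meeting point of the clamped paths lies where neither was clamped.\<close>

lemma paths_cross:
  fixes f1 f2 g1 g2 :: "real \<Rightarrow> real"
  assumes "continuous_on {0..1} f1" "continuous_on {0..1} f2" "continuous_on {0..1} g1" "continuous_on {0..1} g2"
    and f: "\<And>t. t \<in> {0..1} \<Longrightarrow> lo < f2 t \<and> f2 t < hi" "f1 0 \<le> - L" "L \<le> f1 1"
    and g: "\<And>t. t \<in> {0..1} \<Longrightarrow> - L < g1 t \<and> g1 t < L" "g2 0 \<le> lo" "hi \<le> g2 1"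
  obtains s t where "s \<in> {0..1}" "t \<in> {0..1}" "f1 s = g1 t" "f2 s = g2 t"
proof -
  define f where "f = (\<lambda>t. vector [max (- L) (min L (f1 t)), f2 t] :: real^2)"
  define g where "g = (\<lambda>t. vector [g1 t, max lo (min hi (g2 t))] :: real^2)"
  have v: "(vector [x, y] :: real^2) = axis 1 x + axis 2 y" for x y
    by (simp add: vec_eq_iff forall_2 axis_def)
  have L: "- L < L" "lo < hi" using g(1)[of 0] f(1)[of 0] by auto
  have ax: "continuous_on T (\<lambda>t. axis k (c t) :: real^2)" if "continuous_on T c" for T :: "real set" and c and k
    using that unfolding axis_def by (intro continuous_on_vec_lambda) (case_tac "i = k"; simp)
  have "path f" "path g"
    unfolding path_def f_def g_def v using assms(1-4)
    by (auto intro!: continuous_intros ax)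
  moreover have "path_image f \<subseteq> cbox (vector [- L, lo]) (vector [L, hi])"
    "path_image g \<subseteq> cbox (vector [- L, lo]) (vector [L, hi])"
    using f(1) g(1) L unfolding path_image_def f_def g_def
    by (force simp: mem_box_cart forall_2)+
  ultimately obtain z where "z \<in> path_image f" "z \<in> path_image g"
    using fashoda[of f g "vector [- L, lo]" "vector [L, hi]"] f g L
    by (auto simp: f_def g_def pathstart_def pathfinish_def)
  then obtain s t where st: "s \<in> {0..1}" "t \<in> {0..1}" "f s = g t"
    unfolding path_image_def by force
  then have "max (- L) (min L (f1 s)) = g1 t" "f2 s = max lo (min hi (g2 t))"
    unfolding f_def g_def by (metis vector_2)+
  then show ?thesis using that[of s t] st f(1)[of s] g(1)[of t] by (force simp: max_def min_def split: if_splits)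
qed

section \<open>Barrier comparison\<close>

text \<open>For \<open>k > 0\<close> and orthonormal \<open>b\<close>, \<open>e\<close>, the
  superlevel sets are bounded by parabolas opening in direction \<open>b\<close>;
  \<open>k = 0\<close> gives a linear phase.\<close>

lemma concave_phase_parabola:
  assumes "0 \<le> k"
  shows "concave_phase (\<lambda>x. (x - c) \<bullet> b - k / 2 * ((x - c) \<bullet> e)\<^sup>2)
    (\<lambda>x. b - (k * ((x - c) \<bullet> e)) *\<^sub>R e) (k *\<^sub>R outer e)"
proof -
  have "GDERIV (\<lambda>x. (x - c) \<bullet> b - k / 2 * ((x - c) \<bullet> e)\<^sup>2) x :> b - (k * ((x - c) \<bullet> e)) *\<^sub>R e" for x
    unfolding gderiv_def
    by (rule has_derivative_eq_rhs, (rule derivative_intros)+) (auto simp: algebra_simps inner_commute)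
  moreover have "((\<lambda>x. b - (k * ((x - c) \<bullet> e)) *\<^sub>R e) has_derivative (\<lambda>v. - (k *\<^sub>R outer e *v v))) (at x)" for x
    by (rule has_derivative_eq_rhs, (rule derivative_intros)+)
      (auto simp: fun_eq_iff scaleR_matrix_vector_assoc[symmetric] outer_mult_vec inner_commute)
  ultimately show ?thesis
    using assms unfolding concave_phase_def
    by (auto intro: sym_mats_scaleR loewner_scaleR outer_sym outer_nonneg)
qed

text \<open>The gradient vanishes only at \<open>c\<close>, so this phase is used on an annulus
  around \<open>c\<close>.\<close>

lemma concave_phase_radial:
  "concave_phase (\<lambda>x. - (norm (x - c))\<^sup>2) (\<lambda>x. (- 2) *\<^sub>R (x - c)) (2 *\<^sub>R mat 1)"
proof -
  have "GDERIV (\<lambda>x. - (norm (x - c))\<^sup>2) x :> (- 2) *\<^sub>R (x - c)" for x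
    unfolding gderiv_def power2_norm_eq_inner
    by (rule has_derivative_eq_rhs, (rule derivative_intros)+) (auto simp: algebra_simps inner_commute)
  moreover have "((\<lambda>x. (- 2) *\<^sub>R (x - c)) has_derivative (\<lambda>v. - (2 *\<^sub>R mat 1 *v v))) (at x)" for x
    by (rule has_derivative_eq_rhs, (rule derivative_intros)+)
      (auto simp: fun_eq_iff scaleR_matrix_vector_assoc[symmetric])
  moreover have "mat 1 \<in> sym_mats" "loewner_le 0 (mat 1 :: real^'n^'n)"
    by (auto simp: sym_mats_def transpose_mat loewner_le_def)
  ultimately show ?thesis
    unfolding concave_phase_def by (auto intro: sym_mats_scaleR loewner_scaleR)
qed

context harnack_setting
begin

text \<open>By \<open>no_local_max\<close>, the component at \<open>x\<close> of the set where
  \<open>u\<close> plus a small barrier exceeds \<open>u x\<close> reaches the sphere of radius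
  \<open>4 * r\<close>. The barrier stays below \<open>u x / 2\<close>, so \<open>u\<close> exceeds
  \<open>u x / 2\<close> along it.\<close>

lemma ascending_path:
  assumes r: "0 < r" "ball x (8 * r) \<subseteq> \<Omega>" and l: "0 < l" "1 \<le> a * l - H"
    and big: "S powr (1 / (1 + \<alpha>)) < u x / 2 * exp (- 5 * l * r) * l * exp (- 15 * l * r)"
  obtains g where "path g" "pathstart g = x" "path_image g \<subseteq> {y\<in>ball x (4 * r). u x / 2 < u y}"
    "2 * r < norm (pathfinish g - x)"
proof -
  obtain b :: "real^2" where b: "norm b = 1" using vector_choose_size[of 1] by auto
  \<comment> \<open>A linear phase, written as the degenerate parabola \<open>k = 0\<close>.\<close>
  let ?\<psi> = "\<lambda>y. (y - x) \<bullet> b - 0 / 2 * ((y - x) \<bullet> b)\<^sup>2"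
  \<comment> \<open>The phase lies between \<open>- 4 * r\<close> and \<open>4 * r\<close> here. The
    wider bounds \<open>- 15 * r\<close> and \<open>5 * r\<close> are those of the parabolic barrier
    below, so one condition \<open>big\<close> serves both.\<close>
  define m where "m = u x / 2 * exp (- 5 * l * r)"
  have x: "x \<in> \<Omega>" using r by auto
  have m: "m > 0" unfolding m_def using pos[OF x] by simp
  define w where "w = (\<lambda>y. - (u y + m * exp (l * ?\<psi> y)))"
  have cb: "cball x (4 * r) \<subseteq> \<Omega>" using r by (intro order.trans[OF _ r(2)]) (auto simp: subset_iff)
  have \<psi>: "\<bar>?\<psi> y\<bar> \<le> 4 * r" if "y \<in> cball x (4 * r)" for y
    using that Cauchy_Schwarz_ineq2[of "y - x" b] b by (simp add: dist_norm norm_minus_commute)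
  have cl: "closure (ball x (4 * r)) = cball x (4 * r)" using r by simp
  have cw: "continuous_on (closure (ball x (4 * r))) w"
    unfolding w_def cl using continuous_on_subset[OF cont cb] by (intro continuous_intros)
  have nomin: "\<not> local_min_at w y" if y: "y \<in> ball x (4 * r)" for y
  proof -
    have "exp (- 15 * l * r) \<le> exp (l * ?\<psi> y)"
    proof -
      have "l * (- 15 * r) \<le> l * ?\<psi> y" using \<psi>[of y] y l r by (intro mult_left_mono) auto
      then show ?thesis by (simp add: mult_ac)
    qed
    then have "m * l * 1 * exp (- 15 * l * r) \<le> m * l * 1 * exp (l * ?\<psi> y)"
      using m l by (intro mult_left_mono) auto
    then have "\<not> local_max_at (\<lambda>y. u y + m * exp (l * ?\<psi> y)) y"
      using y cb b l m big
      by (intro no_local_max[OF concave_phase_parabola, where ?q0.0 = 1]) (auto simp: trace_def m_def)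
    then show ?thesis unfolding w_def local_min_at_def local_max_at_def neg_le_iff_le .
  qed
  have wx: "w x < - u x" unfolding w_def using m by simp
  have xb: "x \<in> ball x (4 * r)" using r by simp
  obtain W z where W: "open W" "path_connected W" "x \<in> W" "W \<subseteq> {y\<in>ball x (4 * r). w y < - u x}"
    and z: "z \<in> closure W" "z \<in> frontier (ball x (4 * r))" "w z \<le> - u x"
    by (rule sublevel_component_reaches_frontier[OF open_ball bounded_ball cw nomin xb wx])
  have "dist x z = 4 * r" using z r by (simp add: frontier_ball)
  \<comment> \<open>The frontier point \<open>z\<close> is only in the closure of \<open>W\<close>;
    a nearby point of \<open>W\<close> can be joined to \<open>x\<close> and is still farther than
    \<open>2 * r\<close> away.\<close>
  then obtain y where y: "y \<in> W" "2 * r < norm (y - x)"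
    using z(1) r closure_approachable[of z W]
    by (smt (verit) dist_norm dist_triangle_half_r dist_commute dist_triangle)
  obtain g where g: "path g" "path_image g \<subseteq> W" "pathstart g = x" "pathfinish g = y"
    using W y unfolding path_connected_def by blast
  have "u x / 2 < u y'" if "y' \<in> W" for y'
  proof -
    have y': "y' \<in> ball x (4 * r)" "u x < u y' + m * exp (l * ?\<psi> y')" using that W unfolding w_def by auto
    have "l * ?\<psi> y' \<le> l * (5 * r)" using \<psi>[of y'] y' l r by (intro mult_left_mono) auto
    then have "m * exp (l * ?\<psi> y') \<le> m * exp (5 * l * r)" using m by (simp add: mult_ac)
    also have "\<dots> = u x / 2" unfolding m_def by (simp add: exp_minus)
    finally show ?thesis using y' by simp
  qed
  then show ?thesis using that g y W by blast
qed

text \<open>A small value at \<open>p\<close> puts \<open>p\<close> in a sublevel set of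
  \<open>u\<close> minus a parabolic barrier, and the component there can leave the rectangle only
  on the side towards \<open>b\<close>. As the barrier is at most \<open>M / 2\<close>, so is
  \<open>u\<close> along the way. Using \<open>b\<close> and \<open>- b\<close> gives the two halves
  of a crossing.\<close>

lemma crossing_path_one_side:
  assumes r: "0 < r" and box: "{y. \<bar>(y - c) \<bullet> b\<bar> \<le> 5 * r \<and> \<bar>(y - c) \<bullet> e\<bar> \<le> r} \<subseteq> \<Omega>"
    and bd: "bounded {y. \<bar>(y - c) \<bullet> b\<bar> \<le> 5 * r \<and> \<bar>(y - c) \<bullet> e\<bar> \<le> r}"
    and be: "norm b = 1" "norm e = 1" "b \<bullet> e = 0"
    and l: "0 < l" "1 \<le> a * l - A * (20 / r) - H" and M: "0 < M"
    and big: "S powr (1 / (1 + \<alpha>)) < M / 2 * exp (- 5 * l * r) * l * exp (- 15 * l * r)"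
    and p: "p \<in> ball c (r / 2)" "u p < M / 2 * exp (- 5 * l * r) * (exp (- 3 * l * r) - exp (- 5 * l * r))"
  obtains g where "path g" "pathstart g = p" "4 * r \<le> (pathfinish g - c) \<bullet> b"
    "path_image g \<subseteq> {y. \<bar>(y - c) \<bullet> e\<bar> < r \<and> u y < M / 2}"
proof -
  \<comment> \<open>With this \<open>k\<close> the phase is at most \<open>-5r\<close> on all sides of the rectangle except the one where
    \<open>(y - c) \<bullet> b = 5r\<close>, so by positivity of \<open>u\<close> the sublevel component can only leave there.\<close>
  define k where "k = 20 / r"
  have k: "0 \<le> k" unfolding k_def using r by simp
  let ?\<psi> = "\<lambda>y. (y - c) \<bullet> b - k / 2 * ((y - c) \<bullet> e)\<^sup>2"
  let ?q = "\<lambda>y. b - (k * ((y - c) \<bullet> e)) *\<^sub>R e"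
  \<comment> \<open>Normalised by the largest value \<open>5 * r\<close> of the phase on the
    rectangle, where the barrier becomes \<open>M / 2\<close>.\<close>
  define m where "m = M / 2 * exp (- 5 * l * r)"
  have m: "m > 0" unfolding m_def using M by simp
  define w where "w = (\<lambda>y. u y - m * exp (l * ?\<psi> y))"
  define \<kappa> where "\<kappa> = - m * exp (- 5 * l * r)"
  define B where "B = {y. \<bar>(y - c) \<bullet> b\<bar> \<le> 5 * r \<and> \<bar>(y - c) \<bullet> e\<bar> \<le> r}"
  define U where "U = {y. \<bar>(y - c) \<bullet> b\<bar> < 5 * r \<and> \<bar>(y - c) \<bullet> e\<bar> < r}"
  have UB: "U \<subseteq> B" unfolding U_def B_def by auto
  have oU: "open U" unfolding U_def
    by (intro open_Collect_conj open_Collect_less continuous_intros)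
  have cB: "closed B" unfolding B_def
    by (intro closed_Collect_conj closed_Collect_le continuous_intros)
  have clB: "closure U \<subseteq> B" using UB cB by (rule closure_minimal)
  have B\<Omega>: "B \<subseteq> \<Omega>" "bounded B" using box bd unfolding B_def by auto
  \<comment> \<open>In units of \<open>r\<close> the quadratic term is \<open>10 * r\<close> on the
    two sides where the \<open>e\<close> coordinate is \<open>r\<close> or \<open>- r\<close>, and
    at most a quarter of that on \<open>ball c (r / 2)\<close>.\<close>
  have sq: "k / 2 * t\<^sup>2 = 10 * r * (t / r)\<^sup>2" for t
    unfolding k_def using r by (simp add: power2_eq_square field_simps)
  have nq: "1 \<le> norm (?q y)" for y
  proof -
    have "(norm (?q y))\<^sup>2 = 1 + (k * ((y - c) \<bullet> e))\<^sup>2"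
      unfolding power2_norm_eq_inner using be
      by (simp add: inner_diff_left inner_diff_right inner_commute power2_eq_square norm_eq_1)
    then show ?thesis by (metis abs_le_square_iff abs_norm_cancel abs_one le_add_same_cancel1 one_power2 zero_le_power2)
  qed
  have cw: "continuous_on (closure U) w"
    unfolding w_def using continuous_on_subset[OF cont] clB B\<Omega> by (intro continuous_intros) auto
  have nomin: "\<not> local_min_at w y" if y: "y \<in> U" for y
  proof -
    have "\<bar>(y - c) \<bullet> e / r\<bar> \<le> 1" using y r unfolding U_def by (simp add: field_simps)
    then have "((y - c) \<bullet> e / r)\<^sup>2 \<le> 1" by (simp add: abs_square_le_1)
    then have "10 * r * ((y - c) \<bullet> e / r)\<^sup>2 \<le> 10 * r * 1" using r by (intro mult_left_mono) auto
    moreover have "- (5 * r) < (y - c) \<bullet> b" using y unfolding U_def by auto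
    \<comment> \<open>The linear term contributes at least \<open>- 5 * r\<close>, the quadratic one
      at least \<open>- 10 * r\<close>.\<close>
    ultimately have "- 15 * r \<le> ?\<psi> y" unfolding sq by linarith
    then have "l * (- 15 * r) \<le> l * ?\<psi> y" using l by (intro mult_left_mono) auto
    then have "exp (- 15 * l * r) \<le> exp (l * ?\<psi> y)" by (simp add: mult_ac)
    then have "m * l * 1 * exp (- 15 * l * r) \<le> m * l * 1 * exp (l * ?\<psi> y)"
      using m l by (intro mult_left_mono) auto
    then have "S powr (1 / (1 + \<alpha>)) < m * l * 1 * exp (l * ?\<psi> y)" using big unfolding m_def by linarith
    moreover have "trace (k *\<^sub>R outer e) = 20 / r" using be by (simp add: trace_scaleR trace_outer k_def)
    ultimately show ?thesis unfolding w_def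
      using y UB B\<Omega> l m nq r
      by (intro no_local_min[OF concave_phase_parabola[OF k], where ?q0.0 = 1]) auto
  qed
  have p': "p \<in> U" "w p < \<kappa>"
  proof -
    have n: "norm (p - c) < r / 2" using p(1) by (simp add: dist_norm norm_minus_commute)
    have pb: "\<bar>(p - c) \<bullet> b\<bar> < r / 2" "\<bar>(p - c) \<bullet> e\<bar> < r / 2"
      using n be Cauchy_Schwarz_ineq2[of "p - c" b] Cauchy_Schwarz_ineq2[of "p - c" e] by auto
    then show "p \<in> U" unfolding U_def using r by auto
    have "\<bar>(p - c) \<bullet> e / r\<bar> \<le> 1 / 2" using pb r by (simp add: field_simps)
    then have "((p - c) \<bullet> e / r)\<^sup>2 \<le> (1/2)\<^sup>2" using abs_le_square_iff by fastforce
    then have "10 * r * ((p - c) \<bullet> e / r)\<^sup>2 \<le> 10 * r * (1/4)" using r by (intro mult_left_mono) (auto simp: power2_eq_square)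
    \<comment> \<open>Near the centre the loss is at most \<open>r / 2\<close> from the linear term
      and \<open>5 / 2 * r\<close> from the quadratic one. The gap between \<open>- 3 * r\<close>
      and \<open>- 5 * r\<close> is what makes the threshold for \<open>u p\<close>
      positive.\<close>
    then have "- 3 * r \<le> ?\<psi> p" unfolding sq using pb by linarith
    then have "l * (- 3 * r) \<le> l * ?\<psi> p" using l by (intro mult_left_mono) auto
    then have "exp (- 3 * l * r) \<le> exp (l * ?\<psi> p)" by (simp add: mult_ac)
    then have "m * exp (- 3 * l * r) \<le> m * exp (l * ?\<psi> p)" using m by (intro mult_left_mono) auto
    then show "w p < \<kappa>" using p(2) unfolding w_def \<kappa>_def m_def[symmetric] by (simp add: right_diff_distrib)
  qed
  have bU: "bounded U" using UB B\<Omega> bounded_subset by blast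
  obtain W z where W: "open W" "path_connected W" "p \<in> W" "W \<subseteq> {y\<in>U. w y < \<kappa>}"
    and z: "z \<in> closure W" "z \<in> frontier U" "w z \<le> \<kappa>"
    by (rule sublevel_component_reaches_frontier[OF oU bU cw nomin p'])
  have zB: "z \<in> B" "z \<notin> U" using z(2) clB oU by (auto simp: frontier_def interior_open)
  have "0 < u z" using pos zB B\<Omega> by auto
  then have "m * exp (- 5 * l * r) < m * exp (l * ?\<psi> z)" using z(3) unfolding w_def \<kappa>_def by linarith
  then have "l * (- 5 * r) < l * ?\<psi> z" using m by (simp add: mult_ac)
  then have \<psi>z: "- 5 * r < ?\<psi> z" using l by (simp only: mult_less_cancel_left_pos)
  have "(z - c) \<bullet> b = 5 * r"
  proof (rule ccontr)
    assume ne: "(z - c) \<bullet> b \<noteq> 5 * r"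
    have "0 \<le> 10 * r * ((z - c) \<bullet> e / r)\<^sup>2" using r by simp
    then have "(z - c) \<bullet> b \<noteq> - 5 * r" using \<psi>z unfolding sq by linarith
    then have "\<bar>(z - c) \<bullet> e\<bar> = r" using ne zB unfolding B_def U_def by auto
    then have "\<bar>(z - c) \<bullet> e / r\<bar> = 1" using r by simp
    then have "((z - c) \<bullet> e / r)\<^sup>2 = 1" by (metis power2_abs one_power2)
    then show False using \<psi>z zB unfolding sq B_def by auto
  qed
  \<comment> \<open>Moving from the frontier point into \<open>W\<close> costs at most
    \<open>r\<close>, hence \<open>4 * r\<close> instead of \<open>5 * r\<close>.\<close>
  moreover obtain y where y: "y \<in> W" "dist y z < r" using z(1) r closure_approachable by blast
  moreover have "\<bar>(y - z) \<bullet> b\<bar> \<le> norm (y - z)" using be Cauchy_Schwarz_ineq2[of "y - z" b] by simp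
  ultimately have yb: "4 * r \<le> (y - c) \<bullet> b" by (simp add: dist_norm inner_diff_left)
  obtain g where g: "path g" "path_image g \<subseteq> W" "pathstart g = p" "pathfinish g = y"
    using W y unfolding path_connected_def by blast
  have "u y < M / 2" if "y \<in> W" for y
  proof -
    have y: "y \<in> U" "u y < m * exp (l * ?\<psi> y) + \<kappa>" using that W unfolding w_def by auto
    have "0 \<le> 10 * r * ((y - c) \<bullet> e / r)\<^sup>2" using r by simp
    moreover have "(y - c) \<bullet> b < 5 * r" using y(1) unfolding U_def by auto
    ultimately have "?\<psi> y \<le> 5 * r" unfolding sq by linarith
    then have "l * ?\<psi> y \<le> l * (5 * r)" using l by (intro mult_left_mono) auto
    then have "m * exp (l * ?\<psi> y) \<le> m * exp (5 * l * r)" using m by (simp add: mult_ac)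
    also have "\<dots> = M / 2" unfolding m_def by (simp add: exp_minus)
    finally show ?thesis using y(2) m unfolding \<kappa>_def by (smt (verit) exp_gt_zero mult_pos_pos mult_minus_left)
  qed
  then show ?thesis using that[of g] g yb W unfolding U_def by blast
qed

text \<open>Compare \<open>u\<close> with a radial barrier on an annulus. On the inner disc
  \<open>u \<ge> \<mu>\<close> while the barrier is at most \<open>\<mu> / 2\<close>; on the outer
  sphere \<open>u > 0\<close> while the shifted barrier vanishes. A point violating the bound would
  start a sublevel component with nowhere to exit.\<close>

lemma spread_from_ball:
  assumes r: "0 < r" "cball c (4 * r) \<subseteq> \<Omega>" and l: "0 < l" "1 \<le> a * l * (r / 2) - A * 4 / (r / 2) - H"
    and \<mu>: "0 < \<mu>" "\<And>y. y \<in> ball c (r / 2) \<Longrightarrow> \<mu> \<le> u y"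
    and big: "S powr (1 / (1 + \<alpha>)) < \<mu> / 2 * l * (r / 2) * exp (- 16 * l * r\<^sup>2)"
    and y0: "y0 \<in> ball c (4 * r)"
  shows "\<mu> / 2 * (exp (- l * (norm (y0 - c))\<^sup>2) - exp (- 16 * l * r\<^sup>2)) \<le> u y0"
proof (rule ccontr)
  assume no: "\<not> ?thesis"
  define m where "m = \<mu> / 2"
  have m: "m > 0" using \<mu> unfolding m_def by simp
  let ?\<psi> = "\<lambda>y. - (norm (y - c))\<^sup>2"
  define w where "w = (\<lambda>y. u y - m * exp (l * ?\<psi> y))"
  define \<kappa> where "\<kappa> = - m * exp (- 16 * l * r\<^sup>2)"
  \<comment> \<open>Removing the disc of radius \<open>r / 4\<close> keeps the phase gradient at
    least \<open>r / 2\<close>; the closed disc still lies in the ball where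
    \<open>\<mu> \<le> u\<close> is known.\<close>
  define U where "U = ball c (4 * r) - cball c (r / 4)"
  have oU: "open U" unfolding U_def by (simp add: open_Diff)
  have UB: "U \<subseteq> cball c (4 * r)" unfolding U_def by auto
  have clB: "closure U \<subseteq> cball c (4 * r)" using UB by (rule closure_minimal) simp
  have small: "\<mu> \<le> u y" if "norm (y - c) \<le> r / 4" for y
    using \<mu>(2)[of y] that r by (simp add: dist_norm norm_minus_commute)
  have upper: "m * exp (l * ?\<psi> y) \<le> m" for y
    using m l by simp
  have wy: "w y0 < \<kappa>" using no unfolding w_def \<kappa>_def m_def[symmetric] by (simp add: right_diff_distrib)
  have neg: "\<kappa> < 0" unfolding \<kappa>_def using m by simp
  have fin: False if "norm (y - c) \<le> r / 4" "w y \<le> \<kappa>" for y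
    using small[OF that(1)] upper[of y] that(2) neg m unfolding w_def m_def by linarith
  have yU: "y0 \<in> U" using y0 fin[of y0] wy unfolding U_def by (force simp: dist_norm norm_minus_commute)
  have cw: "continuous_on (closure U) w"
    unfolding w_def using continuous_on_subset[OF cont] clB r by (intro continuous_intros) auto
  have nomin: "\<not> local_min_at w y" if y: "y \<in> U" for y
  proof -
    have d: "norm (y - c) < 4 * r" "r / 4 < norm (y - c)"
      using y unfolding U_def by (auto simp: dist_norm norm_minus_commute)
    have "(norm (y - c))\<^sup>2 \<le> (4 * r)\<^sup>2" using d by (intro power_mono) auto
    then have "l * (norm (y - c))\<^sup>2 \<le> l * (16 * r\<^sup>2)" using l by (intro mult_left_mono) (auto simp: power_mult_distrib)
    then have "exp (- 16 * l * r\<^sup>2) \<le> exp (l * ?\<psi> y)" by (simp add: mult_ac)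
    then have "m * l * (r / 2) * exp (- 16 * l * r\<^sup>2) \<le> m * l * (r / 2) * exp (l * ?\<psi> y)"
      using m l r by (intro mult_left_mono) auto
    then have "S powr (1 / (1 + \<alpha>)) < m * l * (r / 2) * exp (l * ?\<psi> y)" using big unfolding m_def by linarith
    moreover have "trace (2 *\<^sub>R mat 1 :: real^2^2) = 4" by (simp add: trace_scaleR trace_I)
    moreover have "r / 2 \<le> norm ((- 2) *\<^sub>R (y - c))" using d by simp
    ultimately show ?thesis unfolding w_def
      using y UB r l m
      by (intro no_local_min[OF concave_phase_radial, where ?q0.0 = "r / 2"]) auto
  qed
  have bU: "bounded U" using UB bounded_subset bounded_cball by blast
  obtain W z where "open W" "path_connected W" "y0 \<in> W" "W \<subseteq> {y\<in>U. w y < \<kappa>}"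
    "z \<in> closure W" and z: "z \<in> frontier U" "w z \<le> \<kappa>"
    by (rule sublevel_component_reaches_frontier[OF oU bU cw nomin yU wy])
  have zB: "z \<in> cball c (4 * r)" "z \<notin> U" using z clB oU by (auto simp: frontier_def interior_open)
  have "norm (z - c) = 4 * r"
    using zB fin[of z] z(2) unfolding U_def by (force simp: dist_norm norm_minus_commute)
  then have "w z = u z + \<kappa>" unfolding w_def \<kappa>_def by (simp add: power_mult_distrib mult_ac)
  then show False using z(2) pos[of z] zB r(2) by auto
qed

end

section \<open>The planar crossing argument and the local lower bound\<close>

lemma orthonormal_pair:
  fixes e :: "real^2"
  assumes "norm e = 1"
  obtains b where "norm b = 1" "b \<bullet> e = 0" "\<And>v. (norm v)\<^sup>2 = (v \<bullet> b)\<^sup>2 + (v \<bullet> e)\<^sup>2"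
proof -
  define b :: "real^2" where "b = vector [e $ 2, - (e $ 1)]"
  have e: "(e $ 1)\<^sup>2 + (e $ 2)\<^sup>2 = 1"
    using assms by (simp add: norm_eq_1 inner_vec_def sum_2 power2_eq_square)
  have "b \<bullet> b = 1" "b \<bullet> e = 0"
    using e by (auto simp: b_def inner_vec_def sum_2 power2_eq_square)
  moreover have "(norm v)\<^sup>2 = (v \<bullet> b)\<^sup>2 + (v \<bullet> e)\<^sup>2" for v
  proof -
    \<comment> \<open>Lagrange's identity, \<open>b\<close> being \<open>e\<close> rotated by a
      quarter turn.\<close>
    have "(v \<bullet> b)\<^sup>2 + (v \<bullet> e)\<^sup>2 = ((v $ 1)\<^sup>2 + (v $ 2)\<^sup>2) * ((e $ 1)\<^sup>2 + (e $ 2)\<^sup>2)"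
      by (simp add: b_def inner_vec_def sum_2 power2_eq_square algebra_simps)
    then show ?thesis unfolding e power2_norm_eq_inner by (simp add: inner_vec_def sum_2 power2_eq_square)
  qed
  ultimately show ?thesis using that norm_eq_1 by blast
qed

context harnack_setting
begin

text \<open>The path where \<open>u > u x / 2\<close> traverses a strip of width
  \<open>2 * r\<close> around \<open>c\<close>. Were \<open>u\<close> too small at some
  \<open>p\<close> near \<open>c\<close>, a path in that strip with \<open>u < u x / 2\<close> would
  run across it through \<open>p\<close>, and the two paths would have to meet.\<close>

lemma lower_bound_near_centre:
  assumes r: "0 < r" "ball x (8 * r) \<subseteq> \<Omega>" and H: "0 \<le> H"
    and l: "0 < l" "1 \<le> a * l - A * (20 / r) - H"
    and big: "S powr (1 / (1 + \<alpha>)) < u x / 2 * exp (- 5 * l * r) * l * exp (- 15 * l * r)"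
  obtains c where "norm (c - x) = r"
    "\<And>p. p \<in> ball c (r / 2) \<Longrightarrow> u x / 2 * exp (- 5 * l * r) * (exp (- 3 * l * r) - exp (- 5 * l * r)) \<le> u p"
proof -
  have "0 \<le> A * (20 / r)" using A r by simp
  then have l': "1 \<le> a * l - H" using l by linarith
  obtain g where g: "path g" "pathstart g = x" "path_image g \<subseteq> {y\<in>ball x (4 * r). u x / 2 < u y}"
    "2 * r < norm (pathfinish g - x)"
    using ascending_path[OF r l(1) l' big] .
  define d where "d = norm (pathfinish g - x)"
  have d: "d > 2 * r" "d > 0" using g r unfolding d_def by auto
  define e where "e = (1 / d) *\<^sub>R (pathfinish g - x)"
  have e: "norm e = 1" using d unfolding e_def by (simp add: d_def)
  obtain b where b: "norm b = 1" "b \<bullet> e = 0" and pyth: "\<And>v. (norm v)\<^sup>2 = (v \<bullet> b)\<^sup>2 + (v \<bullet> e)\<^sup>2"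
    using orthonormal_pair[OF e] by blast
  \<comment> \<open>With this centre the \<open>e\<close> coordinate of the ascending path goes from
    \<open>- r\<close> at \<open>x\<close> to \<open>d - r > r\<close> at its end.\<close>
  define c where "c = x + r *\<^sub>R e"
  have cx: "norm (c - x) = r" using e r unfolding c_def by simp
  have ee: "e \<bullet> e = 1" "e \<bullet> b = 0" using e b by (auto simp: norm_eq_1 inner_commute)
  let ?B = "{y. \<bar>(y - c) \<bullet> b\<bar> \<le> 5 * r \<and> \<bar>(y - c) \<bullet> e\<bar> \<le> r}"
  \<comment> \<open>The half diagonal is \<open>sqrt 26 * r\<close>; together with the distance
    \<open>r\<close> from \<open>c\<close> to \<open>x\<close> this stays inside
    \<open>ball x (8 * r)\<close>.\<close>
  have B6: "norm (y - c) \<le> 6 * r" if "y \<in> ?B" for y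
  proof -
    have "((y - c) \<bullet> b)\<^sup>2 \<le> (5 * r)\<^sup>2" "((y - c) \<bullet> e)\<^sup>2 \<le> r\<^sup>2"
      using that r abs_le_square_iff[of "(y - c) \<bullet> b" "5 * r"] abs_le_square_iff[of "(y - c) \<bullet> e" r] by auto
    then have "(norm (y - c))\<^sup>2 \<le> 26 * r\<^sup>2" unfolding pyth by (simp add: power_mult_distrib)
    also have "\<dots> \<le> (6 * r)\<^sup>2" by (simp add: power_mult_distrib)
    finally show ?thesis using r by (rule_tac power2_le_imp_le) auto
  qed
  have B\<Omega>: "?B \<subseteq> \<Omega>"
  proof
    fix y assume "y \<in> ?B"
    then have "norm (y - x) < 8 * r" using B6[of y] cx norm_triangle_ineq[of "y - c" "c - x"] r by simp
    then show "y \<in> \<Omega>" using r(2) by (auto simp: dist_norm norm_minus_commute)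
  qed
  have bB: "bounded ?B"
    unfolding bounded_def using B6 by (intro exI[of _ c] exI[of _ "6 * r"]) (auto simp: dist_norm norm_minus_commute)
  have Bm: "{y. \<bar>(y - c) \<bullet> - b\<bar> \<le> 5 * r \<and> \<bar>(y - c) \<bullet> e\<bar> \<le> r} = ?B" by simp
  have "x \<in> \<Omega>" using r by auto
  then have ux: "0 < u x" by (rule pos)
  have "u x / 2 * exp (- 5 * l * r) * (exp (- 3 * l * r) - exp (- 5 * l * r)) \<le> u p" if p: "p \<in> ball c (r / 2)" for p
  proof (rule ccontr)
    assume "\<not> ?thesis"
    then have up: "u p < u x / 2 * exp (- 5 * l * r) * (exp (- 3 * l * r) - exp (- 5 * l * r))" by simp
    obtain g1 where g1: "path g1" "pathstart g1 = p" "4 * r \<le> (pathfinish g1 - c) \<bullet> b"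
      "path_image g1 \<subseteq> {y. \<bar>(y - c) \<bullet> e\<bar> < r \<and> u y < u x / 2}"
      using crossing_path_one_side[OF r(1) B\<Omega> bB b(1) e b(2) l ux big p up] .
    obtain g2 where g2: "path g2" "pathstart g2 = p" "4 * r \<le> (pathfinish g2 - c) \<bullet> - b"
      "path_image g2 \<subseteq> {y. \<bar>(y - c) \<bullet> e\<bar> < r \<and> u y < u x / 2}"
      using crossing_path_one_side[of r c "- b" e l "u x" p, unfolded Bm, OF r(1) B\<Omega> bB _ e _ l ux big p up] b by auto
    \<comment> \<open>Both halves start at \<open>p\<close>; reversing the one that goes towards
      \<open>- b\<close> gives a single path crossing from that side to the other.\<close>
    define k where "k = reversepath g2 +++ g1"
    have k: "path k" "pathstart k = pathfinish g2" "pathfinish k = pathfinish g1"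
      "path_image k \<subseteq> {y. \<bar>(y - c) \<bullet> e\<bar> < r \<and> u y < u x / 2}"
      using g1 g2 unfolding k_def by (auto simp: path_image_join)
    have gx: "(g t - c) \<bullet> b = (g t - x) \<bullet> b" "(g t - c) \<bullet> e = (g t - x) \<bullet> e - r" for t
      unfolding c_def using ee by (auto simp: inner_diff_left inner_add_left)
    have ck: "continuous_on {0..1} (\<lambda>t. (k t - c) \<bullet> b)" "continuous_on {0..1} (\<lambda>t. (k t - c) \<bullet> e)"
      "continuous_on {0..1} (\<lambda>t. (g t - c) \<bullet> b)" "continuous_on {0..1} (\<lambda>t. (g t - c) \<bullet> e)"
      using k(1) g(1) unfolding path_def by (auto intro!: continuous_intros)
    have kb: "- r < (k t - c) \<bullet> e \<and> (k t - c) \<bullet> e < r" if "t \<in> {0..1}" for t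
      using k(4) that unfolding path_image_def by (fastforce simp: abs_less_iff image_subset_iff)
    \<comment> \<open>The ascending path stays in \<open>ball x (4 * r)\<close>, so the low path,
      which overshoots \<open>4 * r\<close> at both ends, cannot be bypassed.\<close>
    have gb: "- (4 * r) < (g t - c) \<bullet> b \<and> (g t - c) \<bullet> b < 4 * r" if "t \<in> {0..1}" for t
    proof -
      have "norm (g t - x) < 4 * r" 
        using g(3) that unfolding path_image_def by (auto simp: image_subset_iff dist_norm norm_minus_commute)
      then show ?thesis using Cauchy_Schwarz_ineq2[of "g t - x" b] b unfolding gx by auto
    qed
    have "(k 0 - c) \<bullet> b \<le> - (4 * r)" "4 * r \<le> (k 1 - c) \<bullet> b"
      using k(2,3) g1(3) g2(3) unfolding pathstart_def pathfinish_def by auto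
    moreover have "(g 0 - c) \<bullet> e \<le> - r" using g(2) unfolding gx pathstart_def by simp
    moreover have "r \<le> (g 1 - c) \<bullet> e"
    proof -
      have "(g 1 - x) \<bullet> e = d"
        using d unfolding e_def d_def pathfinish_def
        by (simp add: power2_norm_eq_inner[symmetric] power2_eq_square)
      then show ?thesis using d unfolding gx by simp
    qed
    ultimately obtain s t where st: "s \<in> {0..1}" "t \<in> {0..1}"
      "(k s - c) \<bullet> b = (g t - c) \<bullet> b" "(k s - c) \<bullet> e = (g t - c) \<bullet> e"
      using paths_cross[OF ck kb _ _ gb] by metis
    then have "(norm (k s - g t))\<^sup>2 = 0"
      unfolding pyth by (simp add: inner_diff_left)
    then have "k s = g t" by simp
    then show False
      using k(4) g(3) st(1,2) unfolding path_image_def by (fastforce simp: image_subset_iff)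
  qed
  then show ?thesis using that cx by blast
qed

text \<open>The bound near \<open>c\<close> is the inner datum of the radial barrier. Points of
  \<open>ball x r\<close> are within \<open>2 * r\<close> of \<open>c\<close>, whence the exponent
  \<open>- 4 * k * r\<^sup>2\<close>. The two conditions \<open>big\<close> belong to the planar and
  the radial barriers.\<close>

lemma local_lower_bound:
  assumes r: "0 < r" "ball x (8 * r) \<subseteq> \<Omega>" and H: "0 \<le> H"
    and l: "0 < l" "1 \<le> a * l - A * (20 / r) - H"
    and k: "0 < k" "1 \<le> a * k * (r / 2) - A * 4 / (r / 2) - H"
    and \<delta>: "\<delta> = exp (- 5 * l * r) / 2 * (exp (- 3 * l * r) - exp (- 5 * l * r))"
    and big: "S powr (1 / (1 + \<alpha>)) < u x * (exp (- 5 * l * r) / 2 * l * exp (- 15 * l * r))"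
      "S powr (1 / (1 + \<alpha>)) < u x * (\<delta> / 2 * k * (r / 2) * exp (- 16 * k * r\<^sup>2))"
    and y: "y \<in> ball x r"
  shows "u x * (\<delta> / 2 * (exp (- 4 * k * r\<^sup>2) - exp (- 16 * k * r\<^sup>2))) \<le> u y"
proof -
  have big1: "S powr (1 / (1 + \<alpha>)) < u x / 2 * exp (- 5 * l * r) * l * exp (- 15 * l * r)"
    using big(1) by (simp add: mult_ac)
  obtain c where c: "norm (c - x) = r"
    and low: "\<And>p. p \<in> ball c (r / 2) \<Longrightarrow> u x / 2 * exp (- 5 * l * r) * (exp (- 3 * l * r) - exp (- 5 * l * r)) \<le> u p"
    using lower_bound_near_centre[OF r H l big1] by blast
  have "x \<in> \<Omega>" using r by auto
  then have ux: "0 < u x" by (rule pos)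
  have \<delta>0: "0 < \<delta>" unfolding \<delta> using r l by (intro mult_pos_pos) auto
  have eq: "u x / 2 * exp (- 5 * l * r) * (exp (- 3 * l * r) - exp (- 5 * l * r)) = u x * \<delta>"
    unfolding \<delta> by simp
  have sub: "cball c (4 * r) \<subseteq> \<Omega>"
  proof
    fix z assume "z \<in> cball c (4 * r)"
    then have "norm (z - x) < 8 * r" using c norm_triangle_ineq[of "z - c" "c - x"] r
      by (simp add: dist_norm norm_minus_commute)
    then show "z \<in> \<Omega>" using r(2) by (auto simp: dist_norm norm_minus_commute)
  qed
  have yc: "norm (y - c) \<le> 2 * r"
    using y c norm_triangle_ineq4[of "y - x" "c - x"] by (simp add: dist_norm norm_minus_commute)
  then have yb: "y \<in> ball c (4 * r)" using r by (simp add: dist_norm norm_minus_commute)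
  have low': "u x * \<delta> \<le> u p" if "p \<in> ball c (r / 2)" for p
    using low[OF that] unfolding eq .
  have "0 < u x * \<delta>" using ux \<delta>0 by simp
  moreover have big2: "S powr (1 / (1 + \<alpha>)) < u x * \<delta> / 2 * k * (r / 2) * exp (- 16 * k * r\<^sup>2)"
    using big(2) by (simp add: mult_ac)
  ultimately have "u x * \<delta> / 2 * (exp (- k * (norm (y - c))\<^sup>2) - exp (- 16 * k * r\<^sup>2)) \<le> u y"
    by (intro spread_from_ball[OF r(1) sub k _ low' _ yb])
  moreover have "exp (- 4 * k * r\<^sup>2) \<le> exp (- k * (norm (y - c))\<^sup>2)"
  proof -
    have "(norm (y - c))\<^sup>2 \<le> (2 * r)\<^sup>2" using yc by (intro power_mono) auto
    then have "k * (norm (y - c))\<^sup>2 \<le> k * (4 * r\<^sup>2)" using k by (intro mult_left_mono) (auto simp: power_mult_distrib)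
    then show ?thesis by (simp add: mult_ac)
  qed
  then have "u x * \<delta> / 2 * (exp (- 4 * k * r\<^sup>2) - exp (- 16 * k * r\<^sup>2))
      \<le> u x * \<delta> / 2 * (exp (- k * (norm (y - c))\<^sup>2) - exp (- 16 * k * r\<^sup>2))"
    using ux \<delta>0 by (intro mult_left_mono) auto
  moreover have "u x * (\<delta> / 2 * t) = u x * \<delta> / 2 * t" for t by simp
  ultimately show ?thesis by simp
qed

end

section \<open>Uniform constants and chaining\<close>

text \<open>Quantifying over equation, source, solution and even exponent inside the predicate makes
  \<open>K\<close> uniform in them. The relation is directed; symmetry is recovered later by
  bounding both ways.\<close>

definition harnack_bound :: "real \<Rightarrow> real \<Rightarrow> real \<Rightarrow> (real^2) set \<Rightarrow> real \<Rightarrow> real^2 \<Rightarrow> real^2 \<Rightarrow> bool" where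
  "harnack_bound a A H \<Omega> K x y \<longleftrightarrow> (\<forall>\<alpha> S F h f u. harnack_setting \<alpha> a A H S \<Omega> F h f u \<longrightarrow>
     u x \<le> K * (u y + S powr (1 / (1 + \<alpha>))))"

lemma harnack_boundI:
  assumes "\<And>\<alpha> S F h f u. harnack_setting \<alpha> a A H S \<Omega> F h f u \<Longrightarrow> u x \<le> K * (u y + S powr (1 / (1 + \<alpha>)))"
  shows "harnack_bound a A H \<Omega> K x y"
  using assms unfolding harnack_bound_def by blast

lemma harnack_boundD:
  assumes "harnack_bound a A H \<Omega> K x y" "harnack_setting \<alpha> a A H S \<Omega> F h f u"
  shows "u x \<le> K * (u y + S powr (1 / (1 + \<alpha>)))"
  using assms unfolding harnack_bound_def by blast

lemma harnack_bound_mono: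
  assumes xy: "harnack_bound a A H \<Omega> K x y" and K: "K \<le> K'" and y: "y \<in> \<Omega>"
  shows "harnack_bound a A H \<Omega> K' x y"
proof (rule harnack_boundI)
  fix \<alpha> S F h f u
  assume hs: "harnack_setting \<alpha> a A H S \<Omega> F h f u"
  have "0 < u y" by (rule harnack_setting.pos[OF hs y])
  then have "K * (u y + S powr (1 / (1 + \<alpha>))) \<le> K' * (u y + S powr (1 / (1 + \<alpha>)))"
    using K by (intro mult_right_mono) auto
  then show "u x \<le> K' * (u y + S powr (1 / (1 + \<alpha>)))" using harnack_boundD[OF xy hs] by linarith
qed

text \<open>The source term appears again when the second bound is inserted; positivity of
  \<open>u z\<close> lets the summand 1 absorb it.\<close>

lemma harnack_bound_trans:
  assumes xy: "harnack_bound a A H \<Omega> K x y" and yz: "harnack_bound a A H \<Omega> K' y z"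
    and K: "0 < K" and z: "z \<in> \<Omega>"
  shows "harnack_bound a A H \<Omega> (K * (K' + 1)) x z"
proof (rule harnack_boundI)
  fix \<alpha> S F h f u
  assume hs: "harnack_setting \<alpha> a A H S \<Omega> F h f u"
  let ?s = "S powr (1 / (1 + \<alpha>))"
  have "0 < u z" by (rule harnack_setting.pos[OF hs z])
  have "u x \<le> K * (u y + ?s)" "u y \<le> K' * (u z + ?s)"
    using harnack_boundD[OF xy hs] harnack_boundD[OF yz hs] by auto
  moreover have "K * (u y + ?s) \<le> K * (K' * (u z + ?s) + (u z + ?s))"
    using calculation(2) \<open>0 < u z\<close> K by (intro mult_left_mono) auto
  moreover have "K * (K' * (u z + ?s) + (u z + ?s)) = K * (K' + 1) * (u z + ?s)"
    by (simp add: algebra_simps)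
  ultimately show "u x \<le> K * (K' + 1) * (u z + ?s)" by linarith
qed

text \<open>Either \<open>u x\<close> is controlled by the source term, or
  \<open>local_lower_bound\<close> applies. \<open>K\<close> is chosen before
  \<open>\<Omega>\<close>, \<open>x\<close> and \<open>y\<close>, so it serves all centres with the
  same \<open>r\<close>.\<close>

lemma local_harnack:
  fixes a A H r :: real
  assumes a: "0 < a" and A: "0 \<le> A" and H: "0 \<le> H" and r: "0 < r"
  shows "\<exists>K>0. \<forall>\<Omega> x y. ball x (8 * r) \<subseteq> \<Omega> \<longrightarrow> y \<in> ball x r \<longrightarrow> harnack_bound a A H \<Omega> K x y"
proof -
  \<comment> \<open>The values of \<open>l\<close> and \<open>k\<close> turn the two ellipticity
    conditions of \<open>local_lower_bound\<close> into equalities.\<close>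
  define l where "l = (1 + H + A * (20 / r)) / a"
  define k where "k = (1 + H + A * 4 / (r / 2)) / (a * (r / 2))"
  define \<delta> where "\<delta> = exp (- 5 * l * r) / 2 * (exp (- 3 * l * r) - exp (- 5 * l * r))"
  have "0 \<le> A * (20 / r)" "0 \<le> A * 4 / (r / 2)" using A r by auto
  then have lk: "0 < l" "0 < k" unfolding l_def k_def using a H r by (auto intro!: divide_pos_pos mult_pos_pos)
  have l: "1 \<le> a * l - A * (20 / r) - H" unfolding l_def using a by simp
  have k: "1 \<le> a * k * (r / 2) - A * 4 / (r / 2) - H"
  proof -
    have "a * k * (r / 2) = 1 + H + A * 4 / (r / 2)" unfolding k_def using a r by simp
    then show ?thesis by linarith
  qed
  have \<delta>: "0 < \<delta>" unfolding \<delta>_def using r lk by (intro mult_pos_pos) auto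
  define p1 where "p1 = exp (- 5 * l * r) / 2 * l * exp (- 15 * l * r)"
  define p2 where "p2 = \<delta> / 2 * k * (r / 2) * exp (- 16 * k * r\<^sup>2)"
  define p3 where "p3 = \<delta> / 2 * (exp (- 4 * k * r\<^sup>2) - exp (- 16 * k * r\<^sup>2))"
  have p: "0 < p1" "0 < p2" "0 < p3"
    unfolding p1_def p2_def p3_def using \<delta> lk r by (auto intro!: mult_pos_pos)
  define K where "K = 1 / p1 + 1 / p2 + 1 / p3"
  have K: "1 / p1 \<le> K" "1 / p2 \<le> K" "1 / p3 \<le> K" "0 < K" unfolding K_def using p by (auto simp: add_pos_pos)
  show ?thesis
  proof (intro exI[of _ K] conjI K(4) allI impI harnack_boundI)
    fix \<alpha> S \<Omega> F h f u x y
    assume ball: "ball x (8 * r) \<subseteq> \<Omega>" and y: "y \<in> ball x r" and hs: "harnack_setting \<alpha> a A H S \<Omega> F h f u"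
    interpret harnack_setting \<alpha> a A H S \<Omega> F h f u by (rule hs)
    let ?s = "S powr (1 / (1 + \<alpha>))"
    have y\<Omega>: "0 < u y" using y r ball pos[of y] by (auto simp: subset_iff)
    have s: "0 \<le> ?s" by simp
    have "?s < u x * p1 \<Longrightarrow> ?s < u x * p2 \<Longrightarrow> u x * p3 \<le> u y"
      using local_lower_bound[OF r ball H lk(1) l lk(2) k \<delta>_def _ _ y] unfolding p1_def p2_def p3_def .
    \<comment> \<open>Failure of either largeness condition already bounds \<open>u x\<close> by the
      source term; otherwise \<open>u y\<close> bounds it.\<close>
    then consider "u x * p1 \<le> ?s" | "u x * p2 \<le> ?s" | "u x * p3 \<le> u y" by linarith
    then have "u x \<le> 1 / p1 * ?s \<or> u x \<le> 1 / p2 * ?s \<or> u x \<le> 1 / p3 * u y"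
      using p by cases (auto simp: field_simps)
    then show "u x \<le> K * (u y + ?s)"
      using mult_right_mono[OF K(1) s] mult_right_mono[OF K(2) s] mult_right_mono[OF K(3), of "u y"] y\<Omega> s K(4)
        mult_nonneg_nonneg[of K "u y"] mult_nonneg_nonneg[of K ?s]
      unfolding distrib_left by linarith
  qed
qed

text \<open>Being comparable in both directions is an equivalence relation whose classes are open,
  so connectedness leaves only one. A finite cover of \<open>C\<close> by comparison balls then
  reduces the pairwise constants to finitely many.\<close>

lemma harnack_on_compact:
  fixes \<Omega> C :: "(real^2) set"
  assumes a: "0 < a" and A: "0 \<le> A" and H: "0 \<le> H" and \<Omega>: "open \<Omega>" "connected \<Omega>"
    and C: "compact C" "C \<subseteq> \<Omega>"
  shows "\<exists>K>0. \<forall>x\<in>C. \<forall>y\<in>C. harnack_bound a A H \<Omega> K x y"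
proof -
  let ?E = "harnack_bound a A H \<Omega>"
  have loc: "\<exists>d>0. \<exists>K>0. ball x d \<subseteq> \<Omega> \<and> (\<forall>y\<in>ball x d. ?E K x y \<and> ?E K y x)" if x\<Omega>: "x \<in> \<Omega>" for x
  proof -
    obtain R where R: "R > 0" "ball x R \<subseteq> \<Omega>" using openE[OF \<Omega>(1) x\<Omega>] by blast
    \<comment> \<open>With \<open>R = 9 * r\<close>, the ball of radius \<open>8 * r\<close> about
      any point of \<open>ball x r\<close> stays in \<open>ball x R\<close>, so the local estimate
      holds in both directions.\<close>
    define r where "r = R / 9"
    have r: "0 < r" "R = 9 * r" using R unfolding r_def by auto
    obtain K where K: "0 < K"
      and loc: "\<And>\<Omega> x y. ball x (8 * r) \<subseteq> \<Omega> \<Longrightarrow> y \<in> ball x r \<Longrightarrow> harnack_bound a A H \<Omega> K x y"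
      using local_harnack[OF a A H r(1)] by blast
    have sub: "ball y (8 * r) \<subseteq> \<Omega>" if "y \<in> ball x r" for y
    proof
      fix z assume "z \<in> ball y (8 * r)"
      then have "dist x z < R" using that r dist_triangle[of x z y] by simp
      then show "z \<in> \<Omega>" using R by auto
    qed
    have x: "x \<in> ball x r" using r by simp
    have "?E K x y \<and> ?E K y x" if "y \<in> ball x r" for y
      using loc[OF sub[OF x] that] loc[OF sub[OF that], of x] that by (simp add: dist_commute)
    moreover have "ball x r \<subseteq> \<Omega>" using R r by (auto simp: subset_iff)
    ultimately show ?thesis using r K by blast
  qed
  have chain: "\<exists>K>0. ?E K x y" if "x \<in> \<Omega>" "y \<in> \<Omega>" for x y
  proof -
    have "(\<exists>K>0. ?E K x y) \<and> (\<exists>K>0. ?E K y x)"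
    proof (rule connected_equivalence_relation[OF \<Omega>(2) that, of "\<lambda>x y. (\<exists>K>0. ?E K x y) \<and> (\<exists>K>0. ?E K y x)"])
      have tr: "\<exists>K>0. ?E K x z" if xyz: "\<exists>K>0. ?E K x y" "\<exists>K>0. ?E K y z" "z \<in> \<Omega>" for x y z
      proof -
        obtain K K' where "0 < K" "0 < K'" "?E K x y" "?E K' y z" using xyz(1,2) by blast
        then have "?E (K * (K' + 1)) x z" "0 < K * (K' + 1)" using harnack_bound_trans xyz(3) by (auto intro: mult_pos_pos)
        then show ?thesis by blast
      qed
      fix x y z
      assume "(\<exists>K>0. ?E K x y) \<and> (\<exists>K>0. ?E K y x)" "(\<exists>K>0. ?E K y z) \<and> (\<exists>K>0. ?E K z y)"
        "x \<in> \<Omega>" "y \<in> \<Omega>" "z \<in> \<Omega>"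
      then show "(\<exists>K>0. ?E K x z) \<and> (\<exists>K>0. ?E K z x)" using tr by blast
    next
      fix c assume "c \<in> \<Omega>"
      then obtain d K where d: "d > 0" "K > 0" "ball c d \<subseteq> \<Omega>" "\<forall>y\<in>ball c d. ?E K c y \<and> ?E K y c"
        using loc by blast
      then show "\<exists>T. openin (top_of_set \<Omega>) T \<and> c \<in> T \<and> (\<forall>x\<in>T. (\<exists>K>0. ?E K c x) \<and> (\<exists>K>0. ?E K x c))"
        using \<Omega>(1) by (intro exI[of _ "ball c d"]) (auto simp: openin_open_eq)
    qed auto
    then show ?thesis by blast
  qed
  define N where "N = (\<lambda>x d k. d > 0 \<and> k > 0 \<and> ball x d \<subseteq> \<Omega> \<and> (\<forall>y\<in>ball x d. ?E k x y \<and> ?E k y x))"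
  have "\<exists>d k. N x d k" if "x \<in> \<Omega>" for x using loc[OF that] unfolding N_def by blast
  then obtain d k where "\<And>x. x \<in> \<Omega> \<Longrightarrow> N x (d x) (k x)" by metis
  then have dk: "d x > 0" "k x > 0" "\<forall>y\<in>ball x (d x). ?E (k x) x y \<and> ?E (k x) y x" if "x \<in> \<Omega>" for x
    using that unfolding N_def by blast+
  obtain j where j: "\<And>x y. x \<in> \<Omega> \<Longrightarrow> y \<in> \<Omega> \<Longrightarrow> 0 < j x y \<and> ?E (j x y) x y"
    using chain by metis
  have "x \<in> ball x (d x)" if "x \<in> C" for x using C(2) dk(1) that by (simp add: subset_iff)
  then obtain D where D: "D \<subseteq> C" "finite D" "C \<subseteq> (\<Union>x\<in>D. ball x (d x))"
    by (rule_tac compactE_image[OF C(1), of C "\<lambda>x. ball x (d x)"]) auto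
  \<comment> \<open>The constant of the chain from \<open>x\<close> through the centres
    \<open>p\<close> and \<open>q\<close> to \<open>y\<close>, as composed by two uses of
    \<open>harnack_bound_trans\<close>.\<close>
  define G where "G = (\<lambda>(x, y). k x * (j x y * (k y + 1) + 1))"
  \<comment> \<open>The sum of nonnegative terms dominates each of them; the summand 1 keeps
    \<open>K\<close> positive even if \<open>D\<close> is empty.\<close>
  define K where "K = 1 + (\<Sum>p\<in>D \<times> D. G p)"
  have D\<Omega>: "x \<in> \<Omega>" if "x \<in> D" for x using D C that by blast
  have G: "0 \<le> G (p, q)" if "p \<in> D" "q \<in> D" for p q
  proof -
    have "0 < k p" "0 < k q" "0 < j p q" using dk(2) j D\<Omega> that by blast+
    then show ?thesis unfolding G_def by simp
  qed
  then have G': "0 \<le> G r" if "r \<in> D \<times> D" for r using that by (cases r) simp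
  have "?E K x y" if x: "x \<in> C" and y: "y \<in> C" for x y
  proof -
    obtain p q where pq: "p \<in> D" "q \<in> D" "x \<in> ball p (d p)" "y \<in> ball q (d q)"
      using D(3) x y by blast
    have y\<Omega>: "y \<in> \<Omega>" using y C(2) by blast
    have E: "?E (k p) x p" "?E (j p q) p q" "?E (k q) q y" and pos: "0 < k p" "0 < j p q"
      using pq dk(2,3) j D\<Omega> by blast+
    have "?E (G (p, q)) x y"
      unfolding G_def prod.case
      using harnack_bound_trans[OF E(1) harnack_bound_trans[OF E(2,3) pos(2) y\<Omega>] pos(1) y\<Omega>] .
    moreover have "G (p, q) \<le> (\<Sum>p\<in>D \<times> D. G p)"
      by (rule member_le_sum) (use G' pq D(2) in auto)
    then have "G (p, q) \<le> K" unfolding K_def by simp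
    ultimately show ?thesis using y\<Omega> by (rule harnack_bound_mono)
  qed
  moreover have "0 < K" unfolding K_def using sum_nonneg[of "D \<times> D" G] G' by fastforce
  ultimately show ?thesis by blast
qed

theorem theorem3p2:
  fixes \<alpha> a A :: real and \<Omega> \<Omega>' :: "(real^2) set"
  assumes "\<alpha> > -1"
    and "open \<Omega>" "connected \<Omega>" "bounded \<Omega>"
    and "0 < a" "a \<le> A"
    and "compact (closure \<Omega>')" "closure \<Omega>' \<subseteq> \<Omega>" "\<Omega>' \<noteq> {}"
  shows "\<exists>K :: real \<Rightarrow> real.
    \<forall>(F :: 2 operator) (h :: real^2 \<Rightarrow> real^2) (f :: real^2 \<Rightarrow> real) (u :: real^2 \<Rightarrow> real).
      cond_H1 \<alpha> \<Omega> F \<longrightarrow> cond_H2 \<alpha> a A \<Omega> F \<longrightarrow> cond_H3 \<alpha> \<Omega> F \<longrightarrow> cond_H4 \<Omega> F \<longrightarrow>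
      continuous_on (closure \<Omega>) h \<longrightarrow> bounded (h ` closure \<Omega>) \<longrightarrow> cond_H5 \<alpha> (closure \<Omega>) h \<longrightarrow>
      continuous_on \<Omega> f \<longrightarrow> bounded (f ` \<Omega>) \<longrightarrow>
      viscosity_sol \<alpha> \<Omega> F h f u \<longrightarrow> (\<forall>x\<in>\<Omega>. u x > 0) \<longrightarrow>
      (SUP x\<in>\<Omega>'. u x)
        \<le> K (sup_norm_on (closure \<Omega>) h)
            * ((INF x\<in>\<Omega>'. u x) + sup_norm_on \<Omega> f powr (1 / (1 + \<alpha>)))"
proof -
  have A: "0 \<le> A" using assms by simp
  have norm_le: "norm (g x) \<le> sup_norm_on T g"
    if "bounded (g ` T)" "x \<in> T" for g :: "real^2 \<Rightarrow> 'b::real_normed_vector" and T x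
    unfolding sup_norm_on_def using that
    by (intro cSUP_upper) (auto simp: bounded_iff bdd_above_def)
  have "\<exists>K>0. \<forall>x\<in>closure \<Omega>'. \<forall>y\<in>closure \<Omega>'. harnack_bound a A H \<Omega> K x y" if H: "0 \<le> H" for H
    by (rule harnack_on_compact[OF assms(5) A H assms(2,3,7,8)])
  \<comment> \<open>\<open>K\<close> is chosen as a function of the drift bound alone, before
    \<open>F\<close>, \<open>h\<close>, \<open>f\<close> and \<open>u\<close> are
    introduced.\<close>
  then obtain K where K: "\<And>H. 0 \<le> H \<Longrightarrow> 0 < K H"
    and bound: "\<And>H x y. 0 \<le> H \<Longrightarrow> x \<in> closure \<Omega>' \<Longrightarrow> y \<in> closure \<Omega>' \<Longrightarrow> harnack_bound a A H \<Omega> (K H) x y"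
    by metis
  show ?thesis
  proof (intro exI[of _ K] allI impI)
    fix F :: "2 operator" and h :: "real^2 \<Rightarrow> real^2" and f u :: "real^2 \<Rightarrow> real"
    assume H: "cond_H1 \<alpha> \<Omega> F" "cond_H2 \<alpha> a A \<Omega> F"
      and bd: "bounded (h ` closure \<Omega>)" "bounded (f ` \<Omega>)"
      and u: "viscosity_sol \<alpha> \<Omega> F h f u" "\<forall>x\<in>\<Omega>. u x > 0"
    let ?H = "sup_norm_on (closure \<Omega>) h" and ?S = "sup_norm_on \<Omega> f"
    let ?s = "?S powr (1 / (1 + \<alpha>))"
    have sub: "\<Omega>' \<subseteq> closure \<Omega>'" "\<Omega> \<subseteq> closure \<Omega>" by (auto intro: closure_subset[THEN subsetD])
    obtain x0 where "x0 \<in> \<Omega>'" using assms by blast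
    then have "x0 \<in> closure \<Omega>" using sub assms by blast
    then have H0: "0 \<le> ?H" using norm_le[OF bd(1)] norm_ge_zero order_trans by blast
    have hs: "harnack_setting \<alpha> a A ?H ?S \<Omega> F h f u"
      using assms A H u norm_le[OF bd(1)] norm_le[OF bd(2)] sub
      by unfold_locales auto
    \<comment> \<open>In this form the left side does not involve \<open>y\<close>, so one passes
      first to the infimum over \<open>y\<close> and then to the supremum over \<open>x\<close>,
      using only that \<open>\<Omega>'\<close> is nonempty.\<close>
    have le: "u x / K ?H - ?s \<le> u y" if "x \<in> \<Omega>'" "y \<in> \<Omega>'" for x y
      using harnack_boundD[OF bound[OF H0] hs, of x y] that sub K[OF H0] by (auto simp: field_simps)
    show "(SUP x\<in>\<Omega>'. u x) \<le> K ?H * ((INF x\<in>\<Omega>'. u x) + ?s)"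
    proof (rule cSUP_least[OF assms(9)])
      fix x assume "x \<in> \<Omega>'"
      then have "u x / K ?H - ?s \<le> (INF x\<in>\<Omega>'. u x)" using le by (intro cINF_greatest assms)
      then show "u x \<le> K ?H * ((INF x\<in>\<Omega>'. u x) + ?s)" using K[OF H0] by (simp add: field_simps)
    qed
  qed
qed

end
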